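(* Let $\Phi$ be an $(a,b)$-equiangular system of $n$ lines in a $d$-dimensional orthogonal geometry $V$ over $\mathbb{F}_q$ with $a^2\neq b$, $a\neq0$, $\operatorname{Char}\mathbb{F}_q>d$, let $\beta\in\mathbb{F}_q$, $\beta\neq0$, with $\beta^2=b$, and suppose the two-graph induced by $\Phi$ (with respect to $\beta$) is regular with parameters $(n,\ell,m)$. Assume there is a $\beta$-incoherent subset $\Gamma\subseteq\Phi$ of maximum cardinality among $\beta$-incoherent subsets, with $|\Gamma|=d$, which is linearly independent, and such that $|\Gamma_1(\gamma)|=g_1$ for all $\gamma\in\Phi\setminus\Gamma$; put $g_2=|\Gamma|-g_1$. If $g_1\neq g_2$, then for $i=1,2$, $(\Gamma,\mathcal{B}_i)$ is a $2$-$(d,g_i,\lambda_i)$ design, where $\mathcal{B}_i=(\Gamma_i(\gamma))_{\gamma\in\Phi\setminus\Gamma}$ and $\lambda_i=\frac{\ell(g_i-1)}{2g_j}$ for $j\neq i$. Furthermore, when $n>2d$, $(\Gamma,\mathcal{B}_1)$ is a quasi-symmetric $2$-$(d,g_1,\lambda_1;s_1,s_2)$ design, where $s_1,s_2$ are the smallest non-negative integers with $s_1\equiv g_1-(\rho-1)^2/4$ and $s_2\equiv g_1-(\rho^2-1)/4$ in $\mathbb{F}_q$, $\rho=a\beta^{-1}$. Additionally: if $n=d(d+1)/2$ then $(\Gamma,\mathcal{B}_1)$ is a $4$-design; if $n=2d$ then $(\Gamma,\mathcal{B}_1)$ is a symmetric $2$-$(d,g_1,\lambda_1)$ design in which any two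 distinct blocks meet in $s$ points, with $s=s_1$ or $s=s_2$; and if $g_1=g_2$ then $(\Gamma,\mathcal{B}_1\cup\mathcal{B}_2)$ is a $2$-$(d,d/2,n-d-\ell)$ design.
   Context: An orthogonal geometry is a finite-dimensional vector space over $\mathbb{F}_q$, $q$ odd, with a non-degenerate symmetric bilinear form $\langle\cdot,\cdot\rangle$. $\Phi$ is $(a,b)$-equiangular if $\langle\phi,\phi\rangle=a$ for all $\phi\in\Phi$ and $\langle\phi,\psi\rangle^2=b$ for distinct $\phi,\psi$. A triple of distinct vectors $\phi_j,\phi_k,\phi_\ell$ is coherent if $\langle\phi_j,\phi_k\rangle\langle\phi_k,\phi_\ell\rangle\langle\phi_\ell,\phi_j\rangle=-\beta^3$ (otherwise this product equals $\beta^3$); the two-graph induced by $\Phi$ has point set $\Phi$ and these coherent triples. A two-graph (a family of 3-subsets such that each 4-subset contains an even number of them) is regular with parameters $(n,\ell,m)$ if it has $n$ points, every pair of points lies in exactly $\ell$ coherent triples, and every coherent triple lies in $m$ coherent quadruples (4-sets all of whose 3-subsets are coherent). A subset $\Gamma$ is $\beta$-incoherent if $|\Gamma|\le2$ or it contains no coherent triple. For $\gamma\in\Phi\setminus\Gamma$, $\Gamma$ is split into two non-empty parts $\Gamma_1(\gamma),\Gamma_2(\gamma)$ such that for distinct $\delta,\delta'\in\Gamma$ the triple $\{\gamma,\delta,\delta'\}$ is coherent iff $\delta,\delta'$ lie in different parts, labeled so that $|\Gamma_1(\gamma)|\le|\Gamma_2(\gamma)|$. A $t$-$(v,k,\lambda)$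 design is a $v$-point set with a family of $k$-subsets (blocks) such that every $t$ points lie in exactly $\lambda$ blocks; it is quasi-symmetric with intersection numbers $s_1\le s_2$ if any two distinct blocks meet in $s_1$ or $s_2$ points; a symmetric $2$-design has as many blocks as points. "$\equiv$" means equality of images in $\mathbb{F}_q$.
   Formalization: The congruences defining s_1, s_2 do not force s_1 ≤ s_2 (276 lines in dimension 23 with ρ=5, g_1=7 give s_1=3, s_2=1), so the quasi-symmetric claim is stated with intersection numbers min(s_1,s_2) and max(s_1,s_2). *)

theory Defs
  imports "HOL-Library.Multiset" "HOL-Number_Theory.Residues"
begin

text \<open>The parameter \<open>Basis\<close> of the parent locale only witnesses finite-dimensionality.\<close>

locale orthogonal_geometry = finite_dimensional_vector_space scale Basis
  for scale :: "'k::{finite,field} \<Rightarrow> 'v::ab_group_add \<Rightarrow> 'v" and Basis :: "'v set" +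
  fixes form :: "'v \<Rightarrow> 'v \<Rightarrow> 'k"
  assumes odd_card_field: "odd (card (UNIV :: 'k set))"
    and form_linear: "Vector_Spaces.linear scale (*) (form x)"
    and form_sym: "form x y = form y x"
    and form_nondegenerate: "(\<And>y. form x y = 0) \<Longrightarrow> x = 0"

definition equiangular :: "('v \<Rightarrow> 'v \<Rightarrow> 'k::field) \<Rightarrow> 'k \<Rightarrow> 'k \<Rightarrow> 'v set \<Rightarrow> bool" where
  "equiangular form a b \<Phi> \<longleftrightarrow>
     (\<forall>\<phi>\<in>\<Phi>. form \<phi> \<phi> = a) \<and> (\<forall>\<phi>\<in>\<Phi>. \<forall>\<psi>\<in>\<Phi>. \<phi> \<noteq> \<psi> \<longrightarrow> (form \<phi> \<psi>)\<^sup>2 = b)"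

definition coherent_triples :: "('v \<Rightarrow> 'v \<Rightarrow> 'k::field) \<Rightarrow> 'k \<Rightarrow> 'v set \<Rightarrow> 'v set set" where
  "coherent_triples form \<beta> \<Phi> =
     {{x, y, z} | x y z. x \<in> \<Phi> \<and> y \<in> \<Phi> \<and> z \<in> \<Phi> \<and> x \<noteq> y \<and> y \<noteq> z \<and> z \<noteq> x \<and>
        form x y * form y z * form z x = - (\<beta> ^ 3)}"

definition two_graph :: "'a set \<Rightarrow> 'a set set \<Rightarrow> bool" where
  "two_graph X T \<longleftrightarrow> finite X \<and> (\<forall>t\<in>T. t \<subseteq> X \<and> card t = 3) \<and>
     (\<forall>Q. Q \<subseteq> X \<and> card Q = 4 \<longrightarrow> even (card {t \<in> T. t \<subseteq> Q}))"

definition coherent_quadruple :: "'a set \<Rightarrow> 'a set set \<Rightarrow> 'a set \<Rightarrow> bool" where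
  "coherent_quadruple X T Q \<longleftrightarrow>
     Q \<subseteq> X \<and> card Q = 4 \<and> (\<forall>t. t \<subseteq> Q \<and> card t = 3 \<longrightarrow> t \<in> T)"

definition regular_two_graph ::
  "'a set \<Rightarrow> 'a set set \<Rightarrow> nat \<Rightarrow> nat \<Rightarrow> nat \<Rightarrow> bool" where
  "regular_two_graph X T n l m \<longleftrightarrow> two_graph X T \<and> card X = n \<and>
     (\<forall>x\<in>X. \<forall>y\<in>X. x \<noteq> y \<longrightarrow> card {t \<in> T. {x, y} \<subseteq> t} = l) \<and>
     (\<forall>t\<in>T. card {Q. coherent_quadruple X T Q \<and> t \<subseteq> Q} = m)"

definition incoherent :: "('v \<Rightarrow> 'v \<Rightarrow> 'k::field) \<Rightarrow> 'k \<Rightarrow> 'v set \<Rightarrow> 'v set \<Rightarrow> bool" where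
  "incoherent form \<beta> \<Phi> \<Gamma> \<longleftrightarrow>
     \<Gamma> \<subseteq> \<Phi> \<and> (card \<Gamma> \<le> 2 \<or> \<not> (\<exists>t\<in>coherent_triples form \<beta> \<Phi>. t \<subseteq> \<Gamma>))"

definition max_incoherent :: "('v \<Rightarrow> 'v \<Rightarrow> 'k::field) \<Rightarrow> 'k \<Rightarrow> 'v set \<Rightarrow> 'v set \<Rightarrow> bool" where
  "max_incoherent form \<beta> \<Phi> \<Gamma> \<longleftrightarrow> incoherent form \<beta> \<Phi> \<Gamma> \<and>
     (\<forall>\<Delta>. incoherent form \<beta> \<Phi> \<Delta> \<longrightarrow> card \<Delta> \<le> card \<Gamma>)"

text \<open>The labelled parts \<open>A\<close> and \<open>B\<close> are unique unless they have the same size, in which case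
  the labelling is arbitrary; hence a relation rather than a function.\<close>

definition splits :: "('v \<Rightarrow> 'v \<Rightarrow> 'k::field) \<Rightarrow> 'k \<Rightarrow> 'v set \<Rightarrow> 'v set \<Rightarrow> 'v \<Rightarrow> 'v set \<Rightarrow> 'v set \<Rightarrow> bool"
  where
  "splits form \<beta> \<Phi> \<Gamma> \<gamma> A B \<longleftrightarrow>
     A \<noteq> {} \<and> B \<noteq> {} \<and> A \<union> B = \<Gamma> \<and> A \<inter> B = {} \<and> card A \<le> card B \<and>
     (\<forall>\<delta>\<in>\<Gamma>. \<forall>\<delta>'\<in>\<Gamma>. \<delta> \<noteq> \<delta>' \<longrightarrow>
        ({\<gamma>, \<delta>, \<delta>'} \<in> coherent_triples form \<beta> \<Phi> \<longleftrightarrow>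
           (\<delta> \<in> A \<and> \<delta>' \<in> B \<or> \<delta> \<in> B \<and> \<delta>' \<in> A)))"

text \<open>The two parts always exist, so assuming a labelled splitting in a statement about a maximum
  incoherent subset fixes a choice of labels and nothing else.\<close>

lemma coherent_triples_iff:
  assumes sym: "\<And>x y. form x y = form y x"
    and "x \<in> \<Phi>" "y \<in> \<Phi>" "z \<in> \<Phi>" "x \<noteq> y" "y \<noteq> z" "z \<noteq> x"
  shows "{x, y, z} \<in> coherent_triples form \<beta> \<Phi> \<longleftrightarrow>
           form x y * form y z * form z x = - (\<beta> ^ 3)"
proof
  assume "{x, y, z} \<in> coherent_triples form \<beta> \<Phi>"
  then obtain u v w where uvw: "{x, y, z} = {u, v, w}" "u \<noteq> v" "v \<noteq> w" "w \<noteq> u"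
    and p: "form u v * form v w * form w u = - (\<beta> ^ 3)"
    unfolding coherent_triples_def by blast
  have "(x = u \<and> y = v \<and> z = w) \<or> (x = u \<and> y = w \<and> z = v) \<or> (x = v \<and> y = u \<and> z = w) \<or>
        (x = v \<and> y = w \<and> z = u) \<or> (x = w \<and> y = u \<and> z = v) \<or> (x = w \<and> y = v \<and> z = u)"
  proof -
    have "x \<in> {u, v, w}" "y \<in> {u, v, w}" "z \<in> {u, v, w}" using uvw(1) by blast+
    then show ?thesis using assms(5-7) by blast
  qed
  then show "form x y * form y z * form z x = - (\<beta> ^ 3)"
    using p sym[of u v] sym[of v w] sym[of w u] by (elim disjE conjE) (simp_all add: mult_ac)
next
  assume "form x y * form y z * form z x = - (\<beta> ^ 3)"
  then show "{x, y, z} \<in> coherent_triples form \<beta> \<Phi>"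
    unfolding coherent_triples_def using assms(2-7) by blast
qed

lemma splits_exists:
  fixes form :: "'v \<Rightarrow> 'v \<Rightarrow> 'k::field"
  assumes sym: "\<And>x y. form x y = form y x"
    and two: "(2::'k) \<noteq> 0" and fin: "finite \<Phi>"
    and eq: "equiangular form a b \<Phi>" and \<beta>: "\<beta> \<noteq> 0" "\<beta>\<^sup>2 = b"
    and max: "max_incoherent form \<beta> \<Phi> \<Gamma>" and \<gamma>: "\<gamma> \<in> \<Phi> - \<Gamma>"
  shows "\<exists>A B. splits form \<beta> \<Phi> \<Gamma> \<gamma> A B"
proof -
  let ?T = "coherent_triples form \<beta> \<Phi>"
  define s where "s x y = form x y / \<beta>" for x y
  have s: "s x y = 1 \<or> s x y = -1" if "x \<in> \<Phi>" "y \<in> \<Phi>" "x \<noteq> y" for x y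
  proof -
    have "(form x y)\<^sup>2 = \<beta>\<^sup>2" using eq \<beta>(2) that unfolding equiangular_def by blast
    then show ?thesis unfolding s_def using \<beta>(1) by (auto simp: power2_eq_iff)
  qed
  have s_sym: "s x y = s y x" for x y unfolding s_def using sym by simp
  have neg1: "(1::'k) \<noteq> -1" "(-1::'k) \<noteq> 1"
    using two by (metis add.right_inverse one_add_one)+
  have coh: "{x, y, z} \<in> ?T \<longleftrightarrow> s x y * s y z * s z x = -1"
    if "x \<in> \<Phi>" "y \<in> \<Phi>" "z \<in> \<Phi>" "x \<noteq> y" "y \<noteq> z" "z \<noteq> x" for x y z
  proof -
    have "s x y * s y z * s z x = form x y * form y z * form z x / \<beta> ^ 3"
      by (simp add: s_def power3_eq_cube)
    then show ?thesis
      using coherent_triples_iff[of form, OF sym that, of \<beta>] \<beta>(1) by (simp add: divide_eq_eq)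
  qed
  have \<Gamma>: "\<Gamma> \<subseteq> \<Phi>" "card \<Gamma> \<le> 2 \<or> \<not> (\<exists>t\<in>?T. t \<subseteq> \<Gamma>)"
    and mx: "\<And>\<Delta>. incoherent form \<beta> \<Phi> \<Delta> \<Longrightarrow> card \<Delta> \<le> card \<Gamma>"
    using max unfolding max_incoherent_def incoherent_def by auto
  have fin\<Gamma>: "finite \<Gamma>" using \<Gamma>(1) fin finite_subset by blast
  have no3: "\<not> {x, y, z} \<in> ?T" if "x \<in> \<Gamma>" "y \<in> \<Gamma>" "z \<in> \<Gamma>" "x \<noteq> y" "y \<noteq> z" "z \<noteq> x" for x y z
  proof -
    have "card {x, y, z} \<le> card \<Gamma>" using fin\<Gamma> that by (intro card_mono) auto
    then have "\<not> card \<Gamma> \<le> 2" using that by auto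
    then have "\<forall>t\<in>?T. \<not> t \<subseteq> \<Gamma>" using \<Gamma>(2) by simp
    moreover have "{x, y, z} \<subseteq> \<Gamma>" using that by simp
    ultimately show ?thesis by metis
  qed
  have ins: "\<not> incoherent form \<beta> \<Phi> (insert \<gamma> \<Gamma>)"
    using mx[of "insert \<gamma> \<Gamma>"] fin\<Gamma> \<gamma> by auto
  then have big: "card (insert \<gamma> \<Gamma>) > 2" and ex: "\<exists>t\<in>?T. t \<subseteq> insert \<gamma> \<Gamma>"
    unfolding incoherent_def using \<Gamma>(1) \<gamma> by auto
  obtain t where t: "t \<in> ?T" "t \<subseteq> insert \<gamma> \<Gamma>" using ex by blast
  obtain x y z where xyz: "t = {x, y, z}" "x \<noteq> y" "y \<noteq> z" "z \<noteq> x"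
    using t(1) unfolding coherent_triples_def by blast
  have "\<gamma> = x \<or> \<gamma> = y \<or> \<gamma> = z"
    using no3[of x y z] t xyz by auto
  then obtain u v where uv: "u \<in> \<Gamma>" "v \<in> \<Gamma>" "u \<noteq> v" "{\<gamma>, u, v} \<in> ?T"
  proof (elim disjE)
    assume "\<gamma> = x" then show ?thesis using that[of y z] t xyz by auto
  next
    assume "\<gamma> = y" then show ?thesis using that[of x z] t xyz by (auto simp: insert_commute)
  next
    assume "\<gamma> = z" then show ?thesis using that[of x y] t xyz by (auto simp: insert_commute)
  qed
  define A where "A = {x \<in> \<Gamma>. x \<noteq> u \<and> {\<gamma>, u, x} \<in> ?T}"
  define B where "B = \<Gamma> - A"
  have AB: "A \<noteq> {}" "B \<noteq> {}" "A \<union> B = \<Gamma>" "A \<inter> B = {}"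
    unfolding A_def B_def using uv by auto
  have step: "{\<gamma>, x, y} \<in> ?T \<longleftrightarrow> (x \<in> A \<longleftrightarrow> y \<notin> A)" if xy: "x \<in> \<Gamma>" "y \<in> \<Gamma>" "x \<noteq> y" for x y
  proof -
    have mem: "x \<in> \<Phi>" "y \<in> \<Phi>" "u \<in> \<Phi>" "\<gamma> \<in> \<Phi>" "x \<noteq> \<gamma>" "y \<noteq> \<gamma>" "u \<noteq> \<gamma>"
      using xy uv \<Gamma>(1) \<gamma> by auto
    consider "x = u" | "y = u" | "x \<noteq> u" "y \<noteq> u" by blast
    then show ?thesis
    proof cases
      case 1 then show ?thesis using xy unfolding A_def by auto
    next
      case 2 then show ?thesis using xy unfolding A_def by (auto simp: insert_commute)
    next
      case 3
      have c1: "{\<gamma>, u, x} \<in> ?T \<longleftrightarrow> s \<gamma> u * s u x * s x \<gamma> = -1"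
        by (rule coh) (use mem 3 in auto)
      have c2: "{\<gamma>, u, y} \<in> ?T \<longleftrightarrow> s \<gamma> u * s u y * s y \<gamma> = -1"
        by (rule coh) (use mem 3 in auto)
      have c3: "{\<gamma>, x, y} \<in> ?T \<longleftrightarrow> s \<gamma> x * s x y * s y \<gamma> = -1"
        by (rule coh) (use mem xy in auto)
      have c4: "{u, x, y} \<in> ?T \<longleftrightarrow> s u x * s x y * s y u = -1"
        by (rule coh) (use mem xy 3 in auto)
      have c5: "{u, x, y} \<notin> ?T" using no3[of u x y] uv xy 3 by auto
      have "x \<in> A \<longleftrightarrow> {\<gamma>, u, x} \<in> ?T" "y \<in> A \<longleftrightarrow> {\<gamma>, u, y} \<in> ?T"
        unfolding A_def using xy 3 by auto
      then have A: "x \<in> A \<longleftrightarrow> s \<gamma> u * s u x * s \<gamma> x = -1" "y \<in> A \<longleftrightarrow> s \<gamma> u * s u y * s y \<gamma> = -1"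
        using c1 c2 s_sym[of x \<gamma>] by simp_all
      have n: "s u x * s x y * s u y \<noteq> -1" using c4 c5 s_sym[of y u] by simp
      have v: "s \<gamma> u = 1 \<or> s \<gamma> u = -1" "s u x = 1 \<or> s u x = -1" "s \<gamma> x = 1 \<or> s \<gamma> x = -1"
        "s u y = 1 \<or> s u y = -1" "s y \<gamma> = 1 \<or> s y \<gamma> = -1" "s x y = 1 \<or> s x y = -1"
        using s mem xy 3 by metis+
      have pm: "e * f = 1 \<or> e * f = -1" if "e = 1 \<or> e = -1" "f = 1 \<or> f = -1" for e f :: 'k
        using that by auto
      have sq: "e * (e * f) = f" if "e = 1 \<or> e = -1" for e f :: 'k
        using that by auto
      define p where "p = s \<gamma> u * s u x * s \<gamma> x"
      define q where "q = s \<gamma> u * s u y * s y \<gamma>"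
      have p: "p = 1 \<or> p = -1" and q: "q = 1 \<or> q = -1"
        unfolding p_def q_def using v by (simp_all only: pm)
      have one: "s u x * s x y * s u y = 1"
        using n pm[OF pm[OF v(2) v(6)] v(4)] by blast
      have "s \<gamma> x * s x y * s y \<gamma> = p * q * (s u x * s x y * s u y)"
        unfolding p_def q_def
        by (simp add: mult_ac sq[OF v(1)] sq[OF v(2)] sq[OF v(4)])
      then have r: "s \<gamma> x * s x y * s y \<gamma> = p * q" using one by simp
      show ?thesis
        unfolding c3 A r p_def[symmetric] q_def[symmetric] using p q neg1 by auto
    qed
  qed
  have main: "splits form \<beta> \<Phi> \<Gamma> \<gamma> C D"
    if "C = A \<and> D = B \<or> C = B \<and> D = A" "card C \<le> card D" for C D
  proof -
    have "x \<in> A \<and> y \<in> B \<or> x \<in> B \<and> y \<in> A \<longleftrightarrow> (x \<in> A \<longleftrightarrow> y \<notin> A)" if "x \<in> \<Gamma>" "y \<in> \<Gamma>" for x y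
      using that unfolding B_def by blast
    with step have *: "{\<gamma>, x, y} \<in> ?T \<longleftrightarrow> x \<in> A \<and> y \<in> B \<or> x \<in> B \<and> y \<in> A"
      if "x \<in> \<Gamma>" "y \<in> \<Gamma>" "x \<noteq> y" for x y using that by simp
    from that(1) show ?thesis
    proof (elim disjE conjE)
      assume "C = A" "D = B"
      then show ?thesis unfolding splits_def using AB that(2) * by simp
    next
      assume "C = B" "D = A"
      then show ?thesis unfolding splits_def using AB that(2) *
        by (simp add: Un_commute Int_commute disj_commute)
    qed
  qed
  show ?thesis
    using main[of A B] main[of B A] by (meson nat_le_linear)
qed

text \<open>Blocks form a multiset, so that repeated members of an indexed family of blocks are counted
  separately.  The index \<open>\<lambda>\<close> is a real number so that it can be given by a fraction.\<close>

definition t_design :: "nat \<Rightarrow> nat \<Rightarrow> nat \<Rightarrow> real \<Rightarrow> 'a set \<Rightarrow> 'a set multiset \<Rightarrow> bool" where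
  "t_design t v k lam X \<B> \<longleftrightarrow> finite X \<and> card X = v \<and>
     (\<forall>b\<in>#\<B>. b \<subseteq> X \<and> card b = k) \<and>
     (\<forall>S. S \<subseteq> X \<and> card S = t \<longrightarrow> real (size {#b \<in># \<B>. S \<subseteq> b#}) = lam)"

definition block_intersections :: "(nat \<Rightarrow> bool) \<Rightarrow> 'a set multiset \<Rightarrow> bool" where
  "block_intersections P \<B> \<longleftrightarrow> (\<forall>b\<in>#\<B>. \<forall>b'\<in>#\<B> - {#b#}. P (card (b \<inter> b')))"

definition quasi_symmetric ::
  "nat \<Rightarrow> nat \<Rightarrow> real \<Rightarrow> nat \<Rightarrow> nat \<Rightarrow> 'a set \<Rightarrow> 'a set multiset \<Rightarrow> bool" where
  "quasi_symmetric v k lam s\<^sub>1 s\<^sub>2 X \<B> \<longleftrightarrow> t_design 2 v k lam X \<B> \<and> s\<^sub>1 \<le> s\<^sub>2 \<and>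
     block_intersections (\<lambda>s. s = s\<^sub>1 \<or> s = s\<^sub>2) \<B>"

definition symmetric_design ::
  "nat \<Rightarrow> nat \<Rightarrow> real \<Rightarrow> 'a set \<Rightarrow> 'a set multiset \<Rightarrow> bool" where
  "symmetric_design v k lam X \<B> \<longleftrightarrow> t_design 2 v k lam X \<B> \<and> size \<B> = v"

definition smallest_nat_equiv :: "'k::field \<Rightarrow> nat \<Rightarrow> bool" where
  "smallest_nat_equiv c s \<longleftrightarrow> of_nat s = c \<and> (\<forall>t. of_nat t = c \<longrightarrow> s \<le> t)"

end

theory Submission
  imports Defs "Jordan_Normal_Form.Determinant"
begin

text \<open>
  After switching signs, the Gram matrix of \<open>\<Gamma>\<close> is \<open>(\<rho> - 1)I + J\<close> up to the factor \<open>\<beta>\<close>, and a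
  vector \<open>\<gamma>\<close> outside \<open>\<Gamma>\<close> is represented by the sign vector that is \<open>-1\<close> exactly on \<open>\<Gamma>\<^sub>1 \<gamma>\<close>.
  Since \<open>\<Gamma>\<close> is a basis, the product of two vectors outside \<open>\<Gamma>\<close> is determined by
  \<open>|\<Gamma>\<^sub>1 \<gamma> \<inter> \<Gamma>\<^sub>1 \<gamma>'|\<close>, which therefore takes only two values modulo the characteristic, hence only
  two values. Regularity says that any two points of \<open>\<Gamma>\<close> are separated by exactly \<open>l\<close> of the
  partitions, and double counting yields the 2-designs. If there are as many blocks as pairs of
  points, the incidence matrix \<open>M\<close> between pairs and blocks is square and satisfies
  \<open>M\<^sup>T C M = c I\<close> with \<open>c \<noteq> 0\<close> and \<open>C\<close> invariant under all permutations of the points; so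
  \<open>M M\<^sup>T\<close> is invariant as well, which is the 4-design property.
\<close>

section \<open>Block designs\<close>

text \<open>Congruences in the field become equalities of numbers because an intersection has at
  most \<open>card \<Gamma>\<close> elements, fewer than the characteristic. Three points remain. In
  the quasi-symmetric case both residues must have natural representatives, even one that no two
  blocks attain, so \<rho> has to be shown to lie in the prime field; having more than d vectors
  outside \<Gamma> makes this possible. For n = 2d the parts are not assumed to differ in size, and
  equal sizes must be excluded by a separate arithmetic argument, because separation then says
  nothing about the number of blocks through a point. The matrix C comes from the polynomial (s -
  x)(s - y)/2, which vanishes at both intersection sizes: it combines s choose 2, s and 1, and up to
  normalising constants these are the values of the forms given by the identity, by the intersection
  sizes of pairs, and by the all-ones matrix. Its value at the block size is the constant c; it is
  nonzero because \<rho> is neither 1 nor -1.\<close>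

lemma size_filter_image_mset_set:
  assumes "finite I"
  shows "size {#b \<in># {#F i. i \<in># mset_set I#}. P b#} = card {i \<in> I. P (F i)}"
  using assms by (simp add: filter_mset_image_mset)

lemma t_design_image_mset_setI:
  assumes "finite I" "finite X" "card X = v"
    and "\<And>i. i \<in> I \<Longrightarrow> F i \<subseteq> X" "\<And>i. i \<in> I \<Longrightarrow> card (F i) = k"
    and "\<And>S. S \<subseteq> X \<Longrightarrow> card S = t \<Longrightarrow> real (card {i \<in> I. S \<subseteq> F i}) = lam"
  shows "t_design t v k lam X {#F i. i \<in># mset_set I#}"
  unfolding t_design_def using assms by (auto simp: size_filter_image_mset_set)

text \<open>Deleting one copy of \<open>b\<close> from the multiset amounts to deleting one index
  \<open>i\<close> with \<open>F i = b\<close>. Further copies of \<open>b\<close> come from other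
  indices and count as distinct blocks.\<close>

lemma block_intersections_image_mset_setI:
  assumes fin: "finite I"
    and P: "\<And>i j. i \<in> I \<Longrightarrow> j \<in> I \<Longrightarrow> i \<noteq> j \<Longrightarrow> P (card (F i \<inter> F j))"
  shows "block_intersections P {#F i. i \<in># mset_set I#}"
  unfolding block_intersections_def
proof (intro ballI)
  fix b b'
  assume b: "b \<in># {#F i. i \<in># mset_set I#}" and b': "b' \<in># {#F i. i \<in># mset_set I#} - {#b#}"
  obtain i where i: "i \<in> I" "b = F i" using b fin by auto
  have "{#F i. i \<in># mset_set I#} - {#b#} = {#F i. i \<in># mset_set (I - {i})#}"
    using fin i by (simp add: mset_set.remove)
  then obtain j where "j \<in> I" "j \<noteq> i" "b' = F j" using b' fin by auto
  then show "P (card (b \<inter> b'))" using P[of i j] i by simp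
qed

section \<open>Double counting in uniform families of blocks\<close>

lemma card_Collect_eq_sum:
  "finite I \<Longrightarrow> of_nat (card {i \<in> I. P i}) = (\<Sum>i\<in>I. of_bool (P i) :: 'a::semiring_1)"
  by (simp add: of_bool_def sum.If_cases Int_def)

text \<open>Blocks are indexed by \<open>I\<close> rather than collected in a set, so that equal
  blocks at different indices stay separate, as in the multisets of the theorem.\<close>

locale uniform_blocks =
  fixes I :: "'i set" and X :: "'x set" and F :: "'i \<Rightarrow> 'x set" and k :: nat
  assumes finite_I: "finite I" and finite_X: "finite X"
    and block_subset: "\<And>i. i \<in> I \<Longrightarrow> F i \<subseteq> X"
    and card_block: "\<And>i. i \<in> I \<Longrightarrow> card (F i) = k"
begin

lemma sum_point_block: "i \<in> I \<Longrightarrow> (\<Sum>x\<in>X. of_bool (x \<in> F i)) = (of_nat k :: 'a::semiring_1)"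
  using card_Collect_eq_sum[OF finite_X, of "\<lambda>x. x \<in> F i", where 'a='a] card_block[of i]
    block_subset[of i]
  by (simp add: Collect_conj_eq Int_absorb1)

lemma sum_replication:
  "(\<Sum>x\<in>X. of_nat (card {i \<in> I. x \<in> F i})) = (of_nat (card I * k) :: 'a::semiring_1)"
proof -
  have "(\<Sum>x\<in>X. of_nat (card {i \<in> I. x \<in> F i})) = (\<Sum>x\<in>X. \<Sum>i\<in>I. of_bool (x \<in> F i) :: 'a)"
    by (simp only: card_Collect_eq_sum[OF finite_I])
  also have "\<dots> = (\<Sum>i\<in>I. of_nat k)"
    by (subst sum.swap) (intro sum.cong refl sum_point_block)
  finally show ?thesis by simp
qed

context
  fixes l :: nat
  assumes separation: "\<And>x y. x \<in> X \<Longrightarrow> y \<in> X \<Longrightarrow> x \<noteq> y \<Longrightarrow>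
      card {i \<in> I. (x \<in> F i) \<noteq> (y \<in> F i)} = l"
begin

text \<open>Both sides count the pairs of a point \<open>y\<close> and a block separating \<open>x\<close> from \<open>y\<close>.\<close>

lemma separation_count:
  assumes x: "x \<in> X"
  shows "real (card {i \<in> I. x \<in> F i}) * (real (card X) - 2 * real k) + real (card I) * real k
    = (real (card X) - 1) * real l"
proof -
  have "(\<Sum>y\<in>X. \<Sum>i\<in>I. of_bool ((x \<in> F i) \<noteq> (y \<in> F i))) = (\<Sum>y\<in>X. if y = x then 0 else real l)"
    using separation[OF x]
    by (intro sum.cong refl) (auto simp: card_Collect_eq_sum[OF finite_I, symmetric, where 'a=real])
  also have "\<dots> = (real (card X) - 1) * real l"
  proof -
    have "real (card (X - {x})) = real (card X) - 1"
      using card.remove[OF finite_X x] by simp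
    moreover have "(\<Sum>y\<in>X. if y = x then 0 else real l) = (\<Sum>y\<in>X - {x}. real l)"
      using x finite_X by (subst sum.remove[of X x]) auto
    ultimately show ?thesis by simp
  qed
  finally have 1: "(\<Sum>i\<in>I. \<Sum>y\<in>X. of_bool ((x \<in> F i) \<noteq> (y \<in> F i))) = (real (card X) - 1) * real l"
    by (subst sum.swap)
  \<comment> \<open>A block through \<open>x\<close> separates it from the \<open>card X - k\<close>
    points outside the block, any other block from its \<open>k\<close> points.\<close>
  have "(\<Sum>y\<in>X. of_bool ((x \<in> F i) \<noteq> (y \<in> F i)))
      = of_bool (x \<in> F i) * (real (card X) - 2 * real k) + real k" if i: "i \<in> I" for i
  proof (cases "x \<in> F i")
    case True
    have "(\<Sum>y\<in>X. of_bool ((x \<in> F i) \<noteq> (y \<in> F i))) = (\<Sum>y\<in>X. 1 - of_bool (y \<in> F i) :: real)"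
      using True by (intro sum.cong) auto
    then show ?thesis using True sum_point_block[OF i, where 'a=real] by (simp add: sum_subtractf)
  next
    case False
    then show ?thesis using sum_point_block[OF i, where 'a=real] by simp
  qed
  then have "(\<Sum>i\<in>I. \<Sum>y\<in>X. of_bool ((x \<in> F i) \<noteq> (y \<in> F i)))
      = (\<Sum>i\<in>I. of_bool (x \<in> F i) * (real (card X) - 2 * real k) + real k)"
    by simp
  also have "\<dots> = real (card {i \<in> I. x \<in> F i}) * (real (card X) - 2 * real k) + real (card I) * real k"
    by (simp add: sum.distrib sum_distrib_right[symmetric] card_Collect_eq_sum[OF finite_I])
  finally show ?thesis using 1 by simp
qed

text \<open>The preceding count is a linear equation for the number of blocks through
  \<open>x\<close>, with coefficients independent of \<open>x\<close> and leading coefficient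
  \<open>card X - 2 * k\<close>, so this number is the same for all points. Counting all incidences
  then eliminates \<open>card I\<close>.\<close>

lemma separation_replication:
  assumes x: "x \<in> X" and k: "2 * k \<noteq> card X" "k < card X"
  shows "real (card {i \<in> I. x \<in> F i}) * (2 * (real (card X) - real k)) = (real (card X) - 1) * real l"
proof -
  have nz: "real (card X) - 2 * real k \<noteq> 0" using k(1) by linarith
  have "real (card {i \<in> I. y \<in> F i}) = real (card {i \<in> I. x \<in> F i})" if "y \<in> X" for y
  proof -
    have "real (card {i \<in> I. y \<in> F i}) * (real (card X) - 2 * real k)
        = real (card {i \<in> I. x \<in> F i}) * (real (card X) - 2 * real k)"
      using separation_count[OF x] separation_count[OF that] by linarith
    then show ?thesis using nz by simp
  qed
  then have "(\<Sum>y\<in>X. real (card {i \<in> I. y \<in> F i})) = real (card X) * real (card {i \<in> I. x \<in> F i})"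
    by simp
  then have "real (card X) * real (card {i \<in> I. x \<in> F i}) = real (card I) * real k"
    using sum_replication[where 'a=real] by simp
  then show ?thesis using separation_count[OF x] by (simp add: algebra_simps)
qed

text \<open>On the right, a block through both points is counted twice and a block through exactly
  one of them once; there are \<open>l\<close> of the latter kind.\<close>

lemma separation_pair_count:
  assumes "x \<in> X" "y \<in> X" "x \<noteq> y"
  shows "real l + 2 * real (card {i \<in> I. {x, y} \<subseteq> F i})
    = real (card {i \<in> I. x \<in> F i}) + real (card {i \<in> I. y \<in> F i})"
proof -
  have "real l = (\<Sum>i\<in>I. of_bool ((x \<in> F i) \<noteq> (y \<in> F i)))"
    using separation[OF assms] by (simp add: card_Collect_eq_sum[OF finite_I, symmetric, where 'a=real])
  then have "real l + 2 * real (card {i \<in> I. {x, y} \<subseteq> F i})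
      = (\<Sum>i\<in>I. of_bool ((x \<in> F i) \<noteq> (y \<in> F i)) + 2 * of_bool ({x, y} \<subseteq> F i))"
    by (simp only: card_Collect_eq_sum[OF finite_I, where 'a=real] sum.distrib sum_distrib_left)
  also have "\<dots> = (\<Sum>i\<in>I. of_bool (x \<in> F i) + of_bool (y \<in> F i))"
    by (intro sum.cong refl) auto
  finally show ?thesis
    by (simp only: card_Collect_eq_sum[OF finite_I, where 'a=real] sum.distrib)
qed

text \<open>Origin of the index of the 2-design: with \<open>r\<close> blocks through each point,
  twice the pair count is \<open>2 * r - l\<close>, and \<open>r\<close> is known from
  \<open>separation_replication\<close>.\<close>

lemma separation_pair:
  assumes xy: "x \<in> X" "y \<in> X" "x \<noteq> y" and k: "2 * k \<noteq> card X" "k < card X"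
  shows "real (card {i \<in> I. {x, y} \<subseteq> F i}) = real l * (real k - 1) / (2 * (real (card X) - real k))"
proof -
  define c where "c = real (card X) - real k"
  define r where "r = real (card {i \<in> I. x \<in> F i})"
  have c: "c > 0" using k(2) by (simp add: c_def)
  have rx: "r * (2 * c) = (real (card X) - 1) * real l"
    using separation_replication[OF xy(1) k] by (simp add: r_def c_def)
  have "real (card {i \<in> I. y \<in> F i}) = r"
    using separation_replication[OF xy(2) k] c by (simp add: rx[symmetric] c_def[symmetric])
  then have "real l + 2 * real (card {i \<in> I. {x, y} \<subseteq> F i}) = 2 * r"
    using separation_pair_count[OF xy] by (simp add: r_def)
  then have "2 * real (card {i \<in> I. {x, y} \<subseteq> F i}) = 2 * r - real l" by simp
  then have "2 * real (card {i \<in> I. {x, y} \<subseteq> F i}) * c = (2 * r - real l) * c"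
    by (rule arg_cong)
  also have "\<dots> = r * (2 * c) - real l * c" by (simp add: algebra_simps)
  also have "\<dots> = real l * (real k - 1)"
    unfolding rx by (simp add: c_def algebra_simps)
  finally show ?thesis using c unfolding c_def[symmetric] by (simp add: field_simps)
qed

lemma separation_t_design:
  assumes "card X = v" "2 * k \<noteq> v" "k < v"
  shows "t_design 2 v k (real l * (real k - 1) / (2 * real (v - k))) X {#F i. i \<in># mset_set I#}"
proof (rule t_design_image_mset_setI[OF finite_I finite_X assms(1) block_subset card_block])
  fix S assume "S \<subseteq> X" "card S = 2"
  then obtain x y where "S = {x, y}" "x \<noteq> y" "x \<in> X" "y \<in> X" by (auto simp: card_2_iff)
  then show "real (card {i \<in> I. S \<subseteq> F i}) = real l * (real k - 1) / (2 * real (v - k))"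
    using separation_pair[of x y] assms by (simp add: of_nat_diff)
qed

end

text \<open>The squared deviations of the intersection sizes of a fixed block from \<open>lam\<close> sum to zero.\<close>

lemma symmetric_design_intersection:
  assumes card_I: "card I = card X"
    and r: "\<And>x. x \<in> X \<Longrightarrow> real (card {i \<in> I. x \<in> F i}) = r"
    and lam: "\<And>x y. x \<in> X \<Longrightarrow> y \<in> X \<Longrightarrow> x \<noteq> y \<Longrightarrow> real (card {i \<in> I. {x, y} \<subseteq> F i}) = lam"
    and ij: "i \<in> I" "j \<in> I" "i \<noteq> j"
  shows "real (card (F i \<inter> F j)) = lam"
proof -
  define v where "v = real (card X)"
  have v: "v > 0" using ij(1) finite_I card_I unfolding v_def
    by (metis card_gt_0_iff empty_iff of_nat_0_less_iff)
  have "v * r = v * real k"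
    using sum_replication[where 'a=real] r card_I by (simp add: v_def)
  then have rk: "r = real k" using v by simp
  have pair: "real (card {i \<in> I. {x, y} \<subseteq> F i}) = (if x = y then real k else lam)"
    if "x \<in> X" "y \<in> X" for x y using r[of x] lam[of x y] rk that by auto
  have fin: "finite (F i)" if "i \<in> I" for i using finite_subset[OF block_subset[OF that] finite_X] .
  have s: "real (card (F i \<inter> F m)) = (\<Sum>x\<in>F i. of_bool (x \<in> F m))" for m
    using card_Collect_eq_sum[OF fin[OF ij(1)], of "\<lambda>x. x \<in> F m", where 'a=real]
    by (simp add: Int_def)
  have row: "(\<Sum>y\<in>Y. real (card {i \<in> I. {x, y} \<subseteq> F i})) = real k + (real (card Y) - 1) * lam"
    if "x \<in> Y" "Y \<subseteq> X" for x Y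
  proof -
    have finY: "finite Y" using that finite_X finite_subset by blast
    have "(\<Sum>y\<in>Y. real (card {i \<in> I. {x, y} \<subseteq> F i})) = (\<Sum>y\<in>Y. if x = y then real k else lam)"
      using that by (intro sum.cong refl pair) auto
    also have "\<dots> = (\<Sum>y\<in>Y. lam + (if x = y then real k - lam else 0))"
      by (intro sum.cong) auto
    also have "\<dots> = real k + (real (card Y) - 1) * lam"
      using that finY by (simp add: sum.distrib algebra_simps)
    finally show ?thesis .
  qed
  have lin: "(\<Sum>m\<in>I. real (card (F i \<inter> F m))) = real k * real k"
  proof -
    have "(\<Sum>m\<in>I. real (card (F i \<inter> F m))) = (\<Sum>x\<in>F i. \<Sum>m\<in>I. of_bool (x \<in> F m))"
      unfolding s by (rule sum.swap)
    also have "\<dots> = (\<Sum>x\<in>F i. real k)"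
      using block_subset[OF ij(1)] r rk
      by (intro sum.cong refl) (auto simp: card_Collect_eq_sum[OF finite_I, symmetric, where 'a=real])
    finally show ?thesis using card_block[OF ij(1)] by simp
  qed
  have quad: "(\<Sum>m\<in>I. (real (card (F i \<inter> F m)))\<^sup>2) = real k * (real k + (real k - 1) * lam)"
  proof -
    have "(\<Sum>m\<in>I. (real (card (F i \<inter> F m)))\<^sup>2)
        = (\<Sum>m\<in>I. \<Sum>x\<in>F i. \<Sum>y\<in>F i. of_bool ({x, y} \<subseteq> F m))"
      unfolding s power2_eq_square sum_product by (intro sum.cong refl) auto
    also have "\<dots> = (\<Sum>x\<in>F i. \<Sum>m\<in>I. \<Sum>y\<in>F i. of_bool ({x, y} \<subseteq> F m))"
      by (rule sum.swap)
    also have "\<dots> = (\<Sum>x\<in>F i. \<Sum>y\<in>F i. real (card {i \<in> I. {x, y} \<subseteq> F i}))"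
      unfolding card_Collect_eq_sum[OF finite_I, where 'a=real] by (intro sum.cong refl sum.swap)
    also have "\<dots> = (\<Sum>x\<in>F i. real k + (real k - 1) * lam)"
      using row[OF _ block_subset[OF ij(1)]] card_block[OF ij(1)] by simp
    finally show ?thesis using card_block[OF ij(1)] by simp
  qed
  have param: "real k = 0 \<or> (v - 1) * lam = real k * real k - real k"
  proof (cases "k = 0")
    case False
    then obtain x where x: "x \<in> F i" "x \<in> X"
      using card_block[OF ij(1)] block_subset[OF ij(1)] by (metis card.empty ex_in_conv subsetD)
    have "(\<Sum>y\<in>X. real (card {i \<in> I. {x, y} \<subseteq> F i}))
        = (\<Sum>y\<in>X. \<Sum>m\<in>I. of_bool (x \<in> F m) * of_bool (y \<in> F m))"
      unfolding card_Collect_eq_sum[OF finite_I, where 'a=real] by (intro sum.cong refl) auto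
    also have "\<dots> = (\<Sum>m\<in>I. of_bool (x \<in> F m) * real k)"
      by (subst sum.swap) (simp only: sum_distrib_left[symmetric] sum_point_block cong: sum.cong)
    also have "\<dots> = real k * real k"
      using r[OF x(2)] rk unfolding card_Collect_eq_sum[OF finite_I, where 'a=real]
      by (simp add: sum_distrib_right[symmetric])
    finally show ?thesis using row[OF x(2) order_refl] by (simp add: v_def)
  qed simp
  \<comment> \<open>The relation in \<open>param\<close> was obtained by cancelling
    \<open>k\<close>. For \<open>k = 0\<close> it is recovered from \<open>lam = 0\<close>: two
    different indices force at least two points, and empty blocks contain no pair.\<close>
  have lam0: "lam = 0" if "k = 0"
  proof -
    have "v \<noteq> 1"
    proof
      assume "v = 1"
      then have "card I = 1" using card_I by (simp add: v_def)
      then show False using ij by (auto simp: card_1_singleton_iff)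
    qed
    then have "\<not> card X \<le> 1" using v by (auto simp: v_def le_Suc_eq)
    then obtain x y where xy: "x \<in> X" "y \<in> X" "x \<noteq> y"
      using finite_X by (metis One_nat_def card_le_Suc0_iff_eq)
    have "{i \<in> I. {x, y} \<subseteq> F i} = {}" using card_block that fin by fastforce
    then show ?thesis using lam[OF xy] by (metis card.empty of_nat_0)
  qed
  have vlam: "(v - 1) * lam = real k * real k - real k" using param lam0 by auto
  have "(\<Sum>m\<in>I. (real (card (F i \<inter> F m)) - lam)\<^sup>2)
      = real k * (real k + (real k - 1) * lam) - 2 * lam * (real k * real k) + v * lam\<^sup>2"
    unfolding power2_diff sum.distrib sum_subtractf quad
    using lin card_I by (simp add: v_def sum_distrib_left[symmetric] sum_distrib_right[symmetric] mult.commute)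
  also have "\<dots> = (real k - lam)\<^sup>2"
    using arg_cong[OF vlam, of "\<lambda>t. t * lam"] by (simp add: power2_eq_square algebra_simps)
  finally have tot: "(\<Sum>m\<in>I. (real (card (F i \<inter> F m)) - lam)\<^sup>2) = (real k - lam)\<^sup>2" .
  \<comment> \<open>The term \<open>m = i\<close> alone contributes
    \<open>(real k - lam)\<^sup>2\<close>, which is already the whole total.\<close>
  have "(\<Sum>m\<in>I - {i}. (real (card (F i \<inter> F m)) - lam)\<^sup>2) = 0"
    using tot card_block[OF ij(1)] by (simp add: sum.remove[OF finite_I ij(1)])
  then have "(real (card (F i \<inter> F j)) - lam)\<^sup>2 = 0"
    using ij finite_I by (subst (asm) sum_nonneg_eq_0_iff) auto
  then show ?thesis by simp
qed

end

section \<open>Square matrices over finite index sets and their invariance under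
  permutations\<close>

text \<open>Enumerating the two index sets by the same initial segment of the naturals turns both
  families into square matrices, for which a one-sided inverse is two-sided. In the application the
  index sets are blocks and pairs of points.\<close>

lemma sum_left_inverse_imp_right_inverse:
  fixes L :: "'i \<Rightarrow> 'j \<Rightarrow> 'a::field" and M :: "'j \<Rightarrow> 'i \<Rightarrow> 'a"
  assumes fin: "finite I" "finite J" and card: "card I = card J"
    and LM: "\<And>i j. i \<in> I \<Longrightarrow> j \<in> I \<Longrightarrow> (\<Sum>q\<in>J. L i q * M q j) = of_bool (i = j)"
    and pq: "p \<in> J" "q \<in> J"
  shows "(\<Sum>i\<in>I. M p i * L i q) = of_bool (p = q)"
proof -
  define N where "N = card I"
  obtain f where f: "bij_betw f {0..<N} I" using ex_bij_betw_nat_finite[OF fin(1)] N_def by auto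
  obtain g where g: "bij_betw g {0..<N} J"
    using ex_bij_betw_nat_finite[OF fin(2)] N_def card by auto
  define A where "A = mat N N (\<lambda>(r, s). L (f r) (g s))"
  define B where "B = mat N N (\<lambda>(r, s). M (g r) (f s))"
  have dim: "A \<in> carrier_mat N N" "B \<in> carrier_mat N N" by (auto simp: A_def B_def)
  have fI: "f r \<in> I" if "r < N" for r using f that by (auto simp: bij_betw_def)
  have "A * B = 1\<^sub>m N"
  proof (rule eq_matI)
    fix r s assume "r < dim_row (1\<^sub>m N)" "s < dim_col (1\<^sub>m N)"
    then have rs: "r < N" "s < N" by auto
    have "(A * B) $$ (r, s) = (\<Sum>t\<in>{0..<N}. L (f r) (g t) * M (g t) (f s))"
      using rs by (simp add: A_def B_def scalar_prod_def)
    also have "\<dots> = (\<Sum>q\<in>J. L (f r) q * M q (f s))"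
      by (rule sum.reindex_bij_betw[OF g])
    also have "\<dots> = of_bool (f r = f s)" using LM fI rs by simp
    also have "f r = f s \<longleftrightarrow> r = s" using f rs by (auto simp: bij_betw_def inj_on_def)
    finally show "(A * B) $$ (r, s) = 1\<^sub>m N $$ (r, s)" using rs by simp
  qed (auto simp: A_def B_def)
  then have BA: "B * A = 1\<^sub>m N" by (rule mat_mult_left_right_inverse[OF dim])
  obtain r s where rs: "r < N" "s < N" "g r = p" "g s = q"
    using g pq by (auto simp: bij_betw_def image_iff)
  have "(\<Sum>i\<in>I. M p i * L i q) = (\<Sum>t\<in>{0..<N}. M (g r) (f t) * L (f t) (g s))"
    unfolding rs(3,4) by (rule sum.reindex_bij_betw[OF f, symmetric])
  also have "\<dots> = (B * A) $$ (r, s)"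
    using rs by (simp add: A_def B_def scalar_prod_def)
  also have "\<dots> = of_bool (r = s)" unfolding BA using rs by simp
  also have "r = s \<longleftrightarrow> p = q" using g rs by (auto simp: bij_betw_def inj_on_def)
  finally show ?thesis .
qed

text \<open>Transitivity of the symmetric group on subsets of equal size: a bijection from
  \<open>S\<close> to \<open>T\<close> is glued to one between the complements.\<close>

lemma exists_bij_betw_image:
  assumes "finite X" "S \<subseteq> X" "T \<subseteq> X" "card S = card T"
  shows "\<exists>\<sigma>. bij_betw \<sigma> X X \<and> \<sigma> ` S = T"
proof -
  have fin: "finite S" "finite T" using assms finite_subset by auto
  obtain f where f: "bij_betw f S T" using finite_same_card_bij[OF fin assms(4)] by blast
  have "card (X - S) = card (X - T)" using assms fin by (simp add: card_Diff_subset)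
  then obtain g where g: "bij_betw g (X - S) (X - T)"
    using finite_same_card_bij[of "X - S" "X - T"] assms(1) by blast
  let ?h = "\<lambda>x. if x \<in> S then f x else g x"
  have "bij_betw ?h (S \<union> (X - S)) (T \<union> (X - T))"
  proof (rule bij_betw_combine)
    show "bij_betw ?h S T" using f by (subst bij_betw_cong[of S ?h f]) auto
    show "bij_betw ?h (X - S) (X - T)" using g by (subst bij_betw_cong[of "X - S" ?h g]) auto
  qed auto
  then have "bij_betw ?h X X" using assms by (simp add: Un_absorb1)
  moreover have "?h ` S = T" using f by (auto simp: bij_betw_def)
  ultimately show ?thesis by blast
qed

text \<open>If \<open>M\<close> is square and the product of its transpose, \<open>C\<close> and
  \<open>M\<close> is \<open>K\<close> times the identity, then the transpose times
  \<open>C\<close>, divided by \<open>K\<close>, is a left inverse of \<open>M\<close>, hence also a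
  right inverse. The factors can therefore be rotated so that the Gram matrix of the rows of
  \<open>M\<close> meets \<open>C\<close>.\<close>

lemma gram_inverse:
  fixes M :: "'p \<Rightarrow> 'i \<Rightarrow> 'a::field" and C :: "'p \<Rightarrow> 'p \<Rightarrow> 'a"
  assumes fin: "finite I" "finite P" and card: "card I = card P" and K: "K \<noteq> 0"
    and MCM: "\<And>i j. i \<in> I \<Longrightarrow> j \<in> I \<Longrightarrow>
      (\<Sum>p\<in>P. \<Sum>q\<in>P. M p i * C p q * M q j) = K * of_bool (i = j)"
    and pq: "p \<in> P" "q \<in> P"
  shows "(\<Sum>p'\<in>P. (\<Sum>i\<in>I. M p i * M p' i) * C p' q) = K * of_bool (p = q)"
proof -
  define L where "L i q = (\<Sum>p\<in>P. M p i * C p q) / K" for i q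
  have "(\<Sum>q\<in>P. L i q * M q j) = of_bool (i = j)" if "i \<in> I" "j \<in> I" for i j
  proof -
    have "(\<Sum>q\<in>P. L i q * M q j) = (\<Sum>q\<in>P. \<Sum>p\<in>P. M p i * C p q * M q j) / K"
      by (simp add: L_def sum_distrib_right sum_divide_distrib)
    also have "(\<Sum>q\<in>P. \<Sum>p\<in>P. M p i * C p q * M q j) = K * of_bool (i = j)"
      using MCM[OF that] by (subst sum.swap)
    finally show ?thesis using K by simp
  qed
  then have "(\<Sum>i\<in>I. M p i * L i q) = of_bool (p = q)"
    by (rule sum_left_inverse_imp_right_inverse[OF fin card _ pq])
  then have "(\<Sum>i\<in>I. M p i * (\<Sum>p'\<in>P. M p' i * C p' q)) = K * of_bool (p = q)"
    using K by (simp add: L_def sum_divide_distrib[symmetric] field_simps)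
  moreover have "(\<Sum>p'\<in>P. (\<Sum>i\<in>I. M p i * M p' i) * C p' q)
      = (\<Sum>i\<in>I. M p i * (\<Sum>p'\<in>P. M p' i * C p' q))"
    unfolding sum_distrib_left sum_distrib_right by (subst sum.swap) (simp add: mult_ac)
  ultimately show ?thesis by simp
qed

text \<open>Since \<open>C\<close> is invariant under \<phi>, permuting the rows and columns of
  \<open>G\<close> gives another left inverse of \<open>C\<close> up to the factor \<open>K\<close>,
  and such an inverse is unique: the difference \<open>Y\<close> of corresponding rows is
  annihilated by \<open>C\<close>. Symmetry makes \<open>G\<close> a right inverse too, so
  multiplying by \<open>G\<close> shows \<open>Y\<close> to be zero.\<close>

lemma inverse_invariant:
  fixes G C :: "'p \<Rightarrow> 'p \<Rightarrow> 'a::field"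
  assumes fin: "finite P" and K: "K \<noteq> 0"
    and GC: "\<And>p q. p \<in> P \<Longrightarrow> q \<in> P \<Longrightarrow> (\<Sum>p'\<in>P. G p p' * C p' q) = K * of_bool (p = q)"
    and sym: "\<And>p q. G p q = G q p" "\<And>p q. C p q = C q p"
    and \<phi>: "bij_betw \<phi> P P" and C_inv: "\<And>p q. p \<in> P \<Longrightarrow> q \<in> P \<Longrightarrow> C (\<phi> p) (\<phi> q) = C p q"
    and pr: "p \<in> P" "r \<in> P"
  shows "G (\<phi> p) (\<phi> r) = G p r"
proof -
  have \<phi>P: "\<phi> q \<in> P" if "q \<in> P" for q using \<phi> that by (auto simp: bij_betw_def)
  define Y where "Y p' = G (\<phi> p) (\<phi> p') - G p p'" for p'
  have YC: "(\<Sum>p'\<in>P. Y p' * C p' q) = 0" if q: "q \<in> P" for q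
  proof -
    have "(\<Sum>p'\<in>P. G (\<phi> p) (\<phi> p') * C p' q) = (\<Sum>p'\<in>P. G (\<phi> p) (\<phi> p') * C (\<phi> p') (\<phi> q))"
      using q by (intro sum.cong refl) (simp add: C_inv)
    also have "\<dots> = (\<Sum>p'\<in>P. G (\<phi> p) p' * C p' (\<phi> q))"
      by (rule sum.reindex_bij_betw[OF \<phi>])
    also have "\<dots> = K * of_bool (\<phi> p = \<phi> q)" by (rule GC) (use \<phi>P pr q in auto)
    also have "\<phi> p = \<phi> q \<longleftrightarrow> p = q" using \<phi> pr q by (auto simp: bij_betw_def inj_on_def)
    finally show ?thesis using GC[OF pr(1) q] by (simp add: Y_def left_diff_distrib sum_subtractf)
  qed
  have CG: "(\<Sum>q\<in>P. C p' q * G q r) = K * of_bool (r = p')" if "p' \<in> P" for p'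
    using GC[OF pr(2) that] by (simp add: sym(1)[of r] sym(2)[of p'] mult.commute)
  have "0 = (\<Sum>q\<in>P. (\<Sum>p'\<in>P. Y p' * C p' q) * G q r)" using YC by simp
  also have "\<dots> = (\<Sum>p'\<in>P. Y p' * (\<Sum>q\<in>P. C p' q * G q r))"
    unfolding sum_distrib_left sum_distrib_right by (subst sum.swap) (simp add: mult_ac)
  also have "\<dots> = (\<Sum>p'\<in>P. Y p' * (K * of_bool (r = p')))" using CG by simp
  also have "\<dots> = Y r * K"
    using fin pr by (simp add: of_bool_def if_distrib cong: if_cong)
  finally show ?thesis using K by (simp add: Y_def)
qed

lemma bij_betw_image_subsets:
  assumes fin: "finite X" and \<sigma>: "bij_betw \<sigma> X X"
  shows "bij_betw (image \<sigma>) {p. p \<subseteq> X \<and> card p = k} {p. p \<subseteq> X \<and> card p = k}"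
proof -
  have inj: "inj_on \<sigma> X" using \<sigma> by (rule bij_betw_imp_inj_on)
  have "inj_on (image \<sigma>) {p. p \<subseteq> X \<and> card p = k}"
    by (rule inj_on_subset[OF inj_on_image_Pow[OF inj]]) blast
  moreover have "image \<sigma> ` {p. p \<subseteq> X \<and> card p = k} \<subseteq> {p. p \<subseteq> X \<and> card p = k}"
  proof
    fix p' assume "p' \<in> image \<sigma> ` {p. p \<subseteq> X \<and> card p = k}"
    then obtain p where p: "p \<subseteq> X" "card p = k" "p' = \<sigma> ` p" by blast
    have "card p' = k" using card_image[OF inj_on_subset[OF inj p(1)]] p by simp
    moreover have "p' \<subseteq> X" using p \<sigma> by (auto simp: bij_betw_def)
    ultimately show "p' \<in> {p. p \<subseteq> X \<and> card p = k}" by simp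
  qed
  moreover have "finite {p. p \<subseteq> X \<and> card p = k}" using fin by simp
  ultimately show ?thesis by (simp add: bij_betw_def endo_inj_surj)
qed

section \<open>Pairs of points inside blocks, and blocks through four points\<close>

lemma real_choose_two: "real (s choose 2) = real s * (real s - 1) / 2"
  by (cases s) (simp_all add: choose_two real_of_nat_div algebra_simps)

context uniform_blocks
begin

abbreviation point_pairs :: "'x set set" where
  "point_pairs \<equiv> {p. p \<subseteq> X \<and> card p = 2}"

lemma finite_point_pairs: "finite point_pairs"
  using finite_X by simp

lemma finite_block: "i \<in> I \<Longrightarrow> finite (F i)"
  using finite_subset[OF block_subset finite_X] .

lemma sum_pairs_in_blocks:
  assumes "i \<in> I" "j \<in> I"
  shows "(\<Sum>p\<in>point_pairs. of_bool (p \<subseteq> F i) * of_bool (p \<subseteq> F j)) = real (card (F i \<inter> F j) choose 2)"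
proof -
  have "(\<Sum>p\<in>point_pairs. of_bool (p \<subseteq> F i) * of_bool (p \<subseteq> F j))
      = (\<Sum>p\<in>point_pairs. of_bool (p \<subseteq> F i \<inter> F j) :: real)"
    by (intro sum.cong refl) simp
  also have "\<dots> = real (card {p \<in> point_pairs. p \<subseteq> F i \<inter> F j})"
    by (rule card_Collect_eq_sum[OF finite_point_pairs, symmetric])
  also have "{p \<in> point_pairs. p \<subseteq> F i \<inter> F j} = {p. p \<subseteq> F i \<inter> F j \<and> card p = 2}"
    using block_subset[OF assms(1)] by blast
  also have "card \<dots> = card (F i \<inter> F j) choose 2"
    by (rule n_subsets) (use finite_block assms in simp)
  finally show ?thesis .
qed

lemma sum_pairs_in_block:
  assumes "i \<in> I"
  shows "(\<Sum>p\<in>point_pairs. of_bool (p \<subseteq> F i)) = real (k choose 2)"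
  using sum_pairs_in_blocks[OF assms assms] card_block[OF assms]
  by (simp only: of_bool_conj[symmetric] conj_absorb Int_absorb)

lemma sum_pairs_through_point:
  assumes i: "i \<in> I"
  shows "(\<Sum>p\<in>point_pairs. of_bool (z \<in> p) * of_bool (p \<subseteq> F i)) = (real k - 1) * of_bool (z \<in> F i)"
proof (cases "z \<in> F i")
  case False
  then have "\<not> (z \<in> p \<and> p \<subseteq> F i)" for p by blast
  then show ?thesis using False by (simp only: of_bool_conj[symmetric]) simp
next
  case True
  have "(\<Sum>p\<in>point_pairs. of_bool (z \<in> p) * of_bool (p \<subseteq> F i))
      = (\<Sum>p\<in>point_pairs. of_bool (z \<in> p \<and> p \<subseteq> F i) :: real)"
    by (simp only: of_bool_conj)
  also have "\<dots> = real (card {p \<in> point_pairs. z \<in> p \<and> p \<subseteq> F i})"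
    by (rule card_Collect_eq_sum[OF finite_point_pairs, symmetric])
  also have "{p \<in> point_pairs. z \<in> p \<and> p \<subseteq> F i} = (\<lambda>w. {z, w}) ` (F i - {z})"
  proof (intro equalityI subsetI)
    fix p assume "p \<in> {p \<in> point_pairs. z \<in> p \<and> p \<subseteq> F i}"
    then have p: "card p = 2" "z \<in> p" "p \<subseteq> F i" by simp_all
    have "card (p - {z}) = 1" using p(1,2) by (simp add: card_Diff_singleton)
    then obtain w where "p - {z} = {w}" by (rule card_1_singletonE)
    then have "p = {z, w}" "w \<noteq> z" using p(2) by blast+
    then show "p \<in> (\<lambda>w. {z, w}) ` (F i - {z})" using p by simp
  next
    fix p assume "p \<in> (\<lambda>w. {z, w}) ` (F i - {z})"
    then obtain w where w: "p = {z, w}" "w \<in> F i" "z \<noteq> w" by blast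
    have "z \<in> X" "w \<in> X" using block_subset[OF i] True w(2) by blast+
    then show "p \<in> {p \<in> point_pairs. z \<in> p \<and> p \<subseteq> F i}" using True w by simp
  qed
  also have "card \<dots> = card (F i - {z})"
    by (rule card_image, rule inj_onI) (simp only: doubleton_eq_iff, blast)
  also have "real \<dots> = real k - 1"
    using card.remove[OF finite_block[OF i] True] card_block[OF i] by simp
  finally show ?thesis using True by simp
qed

text \<open>Writing \<open>card (p \<inter> q)\<close> as a sum over common points \<open>z\<close>
  factors the double sum for each \<open>z\<close> into two counts of pairs through
  \<open>z\<close>. Each is \<open>k - 1\<close> if \<open>z\<close> lies in the block and zero
  otherwise.\<close>

lemma sum_pairs_meeting:
  assumes ij: "i \<in> I" "j \<in> I"
  shows "(\<Sum>p\<in>point_pairs. \<Sum>q\<in>point_pairs.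
      of_bool (p \<subseteq> F i) * real (card (p \<inter> q)) * of_bool (q \<subseteq> F j)) = (real k - 1)\<^sup>2 * real (card (F i \<inter> F j))"
proof -
  let ?P = point_pairs
  let ?M = "\<lambda>p i. of_bool (p \<subseteq> F i) :: real"
  have meet: "real (card (p \<inter> q)) = (\<Sum>z\<in>X. of_bool (z \<in> p) * of_bool (z \<in> q))"
    if "p \<in> ?P" for p q
  proof -
    have "p \<inter> q = {z \<in> X. z \<in> p \<and> z \<in> q}" using that by blast
    then show ?thesis by (simp only: card_Collect_eq_sum[OF finite_X] of_bool_conj)
  qed
  have "(\<Sum>p\<in>?P. \<Sum>q\<in>?P. ?M p i * real (card (p \<inter> q)) * ?M q j)
      = (\<Sum>p\<in>?P. \<Sum>q\<in>?P. \<Sum>z\<in>X. (of_bool (z \<in> p) * ?M p i) * (of_bool (z \<in> q) * ?M q j))"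
    by (intro sum.cong refl) (simp only: meet sum_distrib_left sum_distrib_right mult_ac)
  also have "\<dots> = (\<Sum>p\<in>?P. \<Sum>z\<in>X. \<Sum>q\<in>?P. (of_bool (z \<in> p) * ?M p i) * (of_bool (z \<in> q) * ?M q j))"
    by (intro sum.cong refl sum.swap)
  also have "\<dots> = (\<Sum>z\<in>X. (\<Sum>p\<in>?P. of_bool (z \<in> p) * ?M p i) * (\<Sum>q\<in>?P. of_bool (z \<in> q) * ?M q j))"
    by (subst sum.swap) (simp only: sum_product)
  also have "\<dots> = (\<Sum>z\<in>X. (real k - 1)\<^sup>2 * of_bool (z \<in> F i \<and> z \<in> F j))"
    unfolding sum_pairs_through_point[OF ij(1)] sum_pairs_through_point[OF ij(2)]
    by (simp only: power2_eq_square of_bool_conj mult_ac)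
  also have "\<dots> = (real k - 1)\<^sup>2 * real (card {z \<in> X. z \<in> F i \<and> z \<in> F j})"
    by (simp only: card_Collect_eq_sum[OF finite_X] sum_distrib_left)
  also have "{z \<in> X. z \<in> F i \<and> z \<in> F j} = F i \<inter> F j" using block_subset[OF ij(1)] by blast
  finally show ?thesis .
qed

text \<open>The Gram matrix \<open>G\<close> of the square incidence matrix between pairs and blocks is, up to a
  factor, the inverse of a matrix \<open>C\<close> that is invariant under all permutations of the points.\<close>

lemma quad_count_eq:
  assumes card_I: "card I = card X choose 2" and k: "k \<ge> 2"
    and xy: "\<And>i j. i \<in> I \<Longrightarrow> j \<in> I \<Longrightarrow> i \<noteq> j \<Longrightarrow> card (F i \<inter> F j) = x \<or> card (F i \<inter> F j) = y"
    and nxy: "x \<noteq> k" "y \<noteq> k"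
    and S: "S \<subseteq> X" "card S = 4" and T: "T \<subseteq> X" "card T = 4"
  shows "card {i \<in> I. S \<subseteq> F i} = card {i \<in> I. T \<subseteq> F i}"
proof -
  let ?P = point_pairs
  have card_P: "card I = card ?P" unfolding card_I using n_subsets[OF finite_X] by simp
  define M where "M p i = (of_bool (p \<subseteq> F i) :: real)" for p i
  \<comment> \<open>\<open>K\<close> is the value at \<open>s = k\<close> of
    \<open>(s - x) * (s - y) / 2\<close>. The coefficients \<open>al\<close> and \<open>be\<close>
    turn \<open>s * (s - 1) / 2\<close>, the contribution of the identity, into this polynomial;
    their denominators cancel the factors that the other two matrices bring in, and are nonzero
    because \<open>k \<ge> 2\<close>.\<close>
  define K where "K = (real k - real x) * (real k - real y) / 2"
  have K: "K \<noteq> 0" using nxy by (simp add: K_def)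
  define al where "al = (real x + real y - 1) / (2 * (real k - 1)\<^sup>2)"
  define be where "be = - (real x * real y) / (2 * (real (k choose 2))\<^sup>2)"
  define C where "C p q = of_bool (p = q) - al * real (card (p \<inter> q)) - be" for p q :: "'x set"
  have MCM: "(\<Sum>p\<in>?P. \<Sum>q\<in>?P. M p i * C p q * M q j) = K * of_bool (i = j)"
    if ij: "i \<in> I" "j \<in> I" for i j
  proof -
    define s where "s = real (card (F i \<inter> F j))"
    have t1: "(\<Sum>p\<in>?P. \<Sum>q\<in>?P. M p i * of_bool (p = q) * M q j) = s * (s - 1) / 2"
    proof -
      have "(\<Sum>q\<in>?P. M p i * of_bool (p = q) * M q j) = M p i * M p j" if "p \<in> ?P" for p
      proof -
        have "(\<Sum>q\<in>?P. M p i * of_bool (p = q) * M q j) = (\<Sum>q\<in>?P. if p = q then M p i * M q j else 0)"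
          by (intro sum.cong refl) simp
        then show ?thesis using that by (simp only: sum.delta'[OF finite_point_pairs] if_True)
      qed
      then have "(\<Sum>p\<in>?P. \<Sum>q\<in>?P. M p i * of_bool (p = q) * M q j) = (\<Sum>p\<in>?P. M p i * M p j)"
        by (rule sum.cong[OF refl])
      then show ?thesis unfolding M_def sum_pairs_in_blocks[OF ij] real_choose_two s_def .
    qed
    have t2: "(\<Sum>p\<in>?P. \<Sum>q\<in>?P. M p i * real (card (p \<inter> q)) * M q j) = (real k - 1)\<^sup>2 * s"
      unfolding M_def s_def by (rule sum_pairs_meeting[OF ij])
    have t3: "(\<Sum>p\<in>?P. M p i * (\<Sum>q\<in>?P. M q j)) = (real (k choose 2))\<^sup>2"
      unfolding M_def sum_pairs_in_block[OF ij(2)] sum_distrib_right[symmetric]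
        sum_pairs_in_block[OF ij(1)] power2_eq_square ..
    have "(\<Sum>p\<in>?P. \<Sum>q\<in>?P. M p i * C p q * M q j)
        = (\<Sum>p\<in>?P. \<Sum>q\<in>?P. M p i * of_bool (p = q) * M q j
            - al * (M p i * real (card (p \<inter> q)) * M q j) - be * (M p i * M q j))"
      unfolding C_def by (intro sum.cong refl) (simp only: algebra_simps)
    also have "\<dots> = s * (s - 1) / 2 - al * ((real k - 1)\<^sup>2 * s) - be * (real (k choose 2))\<^sup>2"
      by (simp only: sum_subtractf sum_distrib_left[symmetric] t1 t2 t3)
    also have "\<dots> = (s - real x) * (s - real y) / 2"
    proof -
      have "al * ((real k - 1)\<^sup>2 * s) = (real x + real y - 1) * s / 2" using k by (simp add: al_def)
      moreover have "k choose 2 \<noteq> 0" using k by (simp add: binomial_eq_0_iff)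
      then have "be * (real (k choose 2))\<^sup>2 = - (real x * real y) / 2" by (simp add: be_def)
      ultimately show ?thesis by (simp add: field_simps)
    qed
    also have "\<dots> = K * of_bool (i = j)"
    proof (cases "i = j")
      case True
      then show ?thesis using card_block[OF ij(1)] by (simp add: s_def K_def)
    next
      case False
      then have "s = real x \<or> s = real y" using xy[OF ij] by (simp add: s_def)
      then show ?thesis using False by simp
    qed
    finally show ?thesis .
  qed
  define G where "G p q = (\<Sum>i\<in>I. M p i * M q i)" for p q
  have GC: "(\<Sum>p'\<in>?P. G p p' * C p' q) = K * of_bool (p = q)" if "p \<in> ?P" "q \<in> ?P" for p q
    unfolding G_def by (rule gram_inverse[OF finite_I finite_point_pairs card_P K MCM that])
  obtain \<sigma> where \<sigma>: "bij_betw \<sigma> X X" "\<sigma> ` S = T"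
    using exists_bij_betw_image[OF finite_X S(1) T(1)] S T by auto
  have inj: "inj_on \<sigma> X" using \<sigma>(1) by (rule bij_betw_imp_inj_on)
  \<comment> \<open>\<open>C p q\<close> depends only on whether the pairs are equal and on how many
    points they share, and both are preserved by a permutation of the points.\<close>
  have C_inv: "C (\<sigma> ` p) (\<sigma> ` q) = C p q" if "p \<in> ?P" "q \<in> ?P" for p q
  proof -
    have sub: "p \<subseteq> X" "q \<subseteq> X" using that by simp_all
    have "\<sigma> ` p \<inter> \<sigma> ` q = \<sigma> ` (p \<inter> q)" using inj_on_image_Int[OF inj sub] by simp
    moreover have "card (\<sigma> ` (p \<inter> q)) = card (p \<inter> q)"
      by (rule card_image, rule inj_on_subset[OF inj]) (use sub in blast)
    moreover have "\<sigma> ` p = \<sigma> ` q \<longleftrightarrow> p = q" using inj_on_image_eq_iff[OF inj sub] .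
    ultimately show ?thesis by (simp add: C_def)
  qed
  have G_inv: "G (\<sigma> ` p) (\<sigma> ` r) = G p r" if "p \<in> ?P" "r \<in> ?P" for p r
  proof (rule inverse_invariant[OF finite_point_pairs K GC _ _ _ C_inv that])
    show "G p q = G q p" for p q by (simp add: G_def mult.commute)
    show "C p q = C q p" for p q by (simp add: C_def Int_commute eq_commute)
    show "bij_betw (image \<sigma>) ?P ?P" by (rule bij_betw_image_subsets[OF finite_X \<sigma>(1)])
  qed
  \<comment> \<open>An entry of \<open>G\<close> counts the blocks containing the union of two
    pairs. Cutting a 4-set into two disjoint pairs thus makes its block count an entry of
    \<open>G\<close>.\<close>
  have G_card: "G p q = real (card {i \<in> I. p \<union> q \<subseteq> F i})" for p q
    unfolding G_def M_def card_Collect_eq_sum[OF finite_I, where 'a=real]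
    by (intro sum.cong refl) simp
  obtain p q where pq: "p \<in> ?P" "q \<in> ?P" "S = p \<union> q"
  proof -
    have "2 \<le> card S" using S(2) by simp
    then obtain p where p: "p \<subseteq> S" "card p = 2" by (rule obtain_subset_with_card_n) blast
    have finp: "finite p" using p(2) by (simp add: card_ge_0_finite)
    have "card (S - p) = 2" using p S by (simp add: card_Diff_subset[OF finp])
    then have "p \<in> ?P" "S - p \<in> ?P" "S = p \<union> (S - p)" using p S by auto
    then show ?thesis by (rule that)
  qed
  have "real (card {i \<in> I. S \<subseteq> F i}) = real (card {i \<in> I. T \<subseteq> F i})"
    using G_inv[OF pq(1,2)] unfolding G_card by (simp only: pq(3)[symmetric] \<sigma>(2) image_Un[symmetric])
  then show ?thesis by simp
qed

end

section \<open>Least natural representatives of field elements\<close>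

lemma smallest_nat_equivI:
  fixes c :: "'k::field"
  assumes "s < CHAR('k)" "of_nat s = c"
  shows "smallest_nat_equiv c s"
  unfolding smallest_nat_equiv_def
proof (intro conjI allI impI)
  fix t assume "of_nat t = c"
  then have "[t = s] (mod CHAR('k))" using assms(2) by (simp add: of_nat_eq_iff_cong_CHAR[symmetric])
  then have "t mod CHAR('k) = s" using assms(1) by (simp add: cong_def)
  then show "s \<le> t" using mod_less_eq_dividend by blast
qed (rule assms(2))

lemma smallest_nat_equiv_unique:
  "smallest_nat_equiv c s \<Longrightarrow> smallest_nat_equiv c t \<Longrightarrow> s = t"
  unfolding smallest_nat_equiv_def by (simp add: le_antisym)

text \<open>Division by 4 stays in the prime field: the characteristic \<open>p\<close> is odd, so
  \<open>(p + 1) / 2\<close> is an integer \<open>h\<close> representing one half, and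
  \<open>z * (h * h)\<close> reduced modulo \<open>p\<close> represents the quotient.\<close>

lemma smallest_nat_equiv_quarter:
  fixes z :: int
  assumes pos: "CHAR('k::field) > 0" and two: "(2::'k) \<noteq> 0"
  shows "\<exists>s. smallest_nat_equiv (of_int z / 4 :: 'k) s"
proof -
  let ?p = "CHAR('k)"
  have "odd ?p"
  proof
    assume "even ?p"
    moreover have "prime ?p" using pos by (rule prime_CHAR_semidom)
    ultimately have "2 = ?p" by (intro primes_dvd_imp_eq[OF two_is_prime_nat])
    then have "of_nat 2 = (0::'k)" using of_nat_CHAR[where 'a='k] by simp
    then show False using two by simp
  qed
  then have "2 * ((?p + 1) div 2) = ?p + 1" by simp
  then have "of_nat (2 * ((?p + 1) div 2)) = (of_nat (?p + 1) :: 'k)" by (rule arg_cong)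
  then have half: "2 * of_nat ((?p + 1) div 2) = (1::'k)"
    by (simp only: of_nat_mult of_nat_add of_nat_CHAR) simp
  define h where "h = int ((?p + 1) div 2)"
  have h: "2 * of_int h = (1::'k)" using half by (simp add: h_def)
  have four: "(4::'k) \<noteq> 0" using no_zero_divisors[OF two two] by simp
  have "of_int (z * (h * h)) * 4 = (of_int z * ((2 * of_int h) * (2 * of_int h)) :: 'k)"
    by simp
  also have "\<dots> = of_int z" unfolding h by simp
  finally have q: "of_int z / 4 = (of_int (z * (h * h)) :: 'k)"
    using nonzero_eq_divide_eq[OF four] by metis
  define w where "w = z * (h * h)"
  have "of_int w = (of_int (int ?p * (w div int ?p) + w mod int ?p) :: 'k)" by simp
  also have "\<dots> = of_int (w mod int ?p)"
    by (simp only: of_int_add of_int_mult of_int_of_nat_eq of_nat_CHAR) simp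
  also have "w mod int ?p = int (nat (w mod int ?p))" using pos by simp
  finally have "of_nat (nat (w mod int ?p)) = (of_int z / 4 :: 'k)"
    unfolding q w_def[symmetric] by (simp only: of_int_of_nat_eq)
  moreover have "nat (w mod int ?p) < ?p" using pos by (simp add: nat_less_iff)
  ultimately show ?thesis using smallest_nat_equivI by blast
qed

section \<open>Maximum incoherent bases\<close>

locale incoherent_basis = orthogonal_geometry scale Basis form
  for scale :: "'k::{finite,field} \<Rightarrow> 'v::ab_group_add \<Rightarrow> 'v" and Basis form +
  fixes \<Phi> \<Gamma> :: "'v set" and \<Gamma>\<^sub>1 \<Gamma>\<^sub>2 :: "'v \<Rightarrow> 'v set" and a b \<beta> :: 'k and g\<^sub>1 g\<^sub>2 :: nat
  assumes finite_\<Phi>: "finite \<Phi>"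
    and equiangular: "equiangular form a b \<Phi>" and ab: "a\<^sup>2 \<noteq> b" and \<beta>: "\<beta> \<noteq> 0" "\<beta>\<^sup>2 = b"
    and max_incoherent: "max_incoherent form \<beta> \<Phi> \<Gamma>"
    and card_\<Gamma>: "card \<Gamma> = dim UNIV"
    and independent: "independent \<Gamma>"
    and char: "CHAR('k) > card \<Gamma>"
    and splits: "\<And>\<gamma>. \<gamma> \<in> \<Phi> - \<Gamma> \<Longrightarrow> splits form \<beta> \<Phi> \<Gamma> \<gamma> (\<Gamma>\<^sub>1 \<gamma>) (\<Gamma>\<^sub>2 \<gamma>)"
    and g\<^sub>1: "\<And>\<gamma>. \<gamma> \<in> \<Phi> - \<Gamma> \<Longrightarrow> card (\<Gamma>\<^sub>1 \<gamma>) = g\<^sub>1"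
    and g\<^sub>2: "g\<^sub>1 + g\<^sub>2 = card \<Gamma>"
begin

text \<open>Dividing by \<beta> turns products of distinct vectors of \<Phi> into signs, the product
  of a vector of \<Phi> with itself into \<rho>, and coherence of a triple into the condition that
  its three signs multiply to -1.\<close>

definition nform :: "'v \<Rightarrow> 'v \<Rightarrow> 'k" where "nform x y = form x y / \<beta>"

definition \<rho> :: 'k where "\<rho> = a * inverse \<beta>"

lemma nform_sym: "nform x y = nform y x"
  by (simp add: nform_def form_sym)

lemma nform_scale: "nform x (scale c y) = c * nform x y"
proof -
  interpret Vector_Spaces.linear scale "(*)" "form x" by (rule form_linear)
  show ?thesis by (simp add: nform_def scale)
qed

lemma nform_sum: "nform x (\<Sum>i\<in>A. h i) = (\<Sum>i\<in>A. nform x (h i))"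
proof -
  interpret Vector_Spaces.linear scale "(*)" "form x" by (rule form_linear)
  show ?thesis by (simp add: nform_def sum sum_divide_distrib)
qed

lemma nform_self: "x \<in> \<Phi> \<Longrightarrow> nform x x = \<rho>"
  using equiangular by (simp add: nform_def \<rho>_def equiangular_def divide_inverse)

lemma nform_cases:
  assumes "x \<in> \<Phi>" "y \<in> \<Phi>" "x \<noteq> y"
  shows "nform x y = 1 \<or> nform x y = -1"
proof -
  have "(form x y)\<^sup>2 = \<beta>\<^sup>2" using equiangular \<beta>(2) assms unfolding equiangular_def by blast
  then show ?thesis unfolding nform_def using \<beta>(1) by (auto simp: power2_eq_iff)
qed

text \<open>This is \<open>a\<^sup>2 \<noteq> b\<close> in normalised form. It keeps the two
  intersection residues away from the block size and makes \<open>\<rho> - t\<close> cancellable for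
  a sign \<open>t\<close>.\<close>

lemma \<rho>_neq: "\<rho> \<noteq> 1" "\<rho> \<noteq> -1"
proof -
  have "\<rho>\<^sup>2 \<noteq> 1" using ab \<beta> by (simp add: \<rho>_def power_mult_distrib power_inverse field_simps)
  then show "\<rho> \<noteq> 1" "\<rho> \<noteq> -1" by auto
qed

lemma two_neq_0: "(2::'k) \<noteq> 0"
proof
  assume "(2::'k) = 0"
  then have "of_nat 2 = (0::'k)" by simp
  then have "CHAR('k) dvd 2" by (simp only: of_nat_eq_0_iff_char_dvd)
  then have "CHAR('k) = 1 \<or> CHAR('k) = 2" using dvd_imp_le[of "CHAR('k)" 2] by (cases "CHAR('k)") auto
  moreover have "CHAR('k) \<noteq> 1" by simp
  ultimately have "2 dvd card (UNIV :: 'k set)" using CHAR_dvd_CARD[where 'a='k] by metis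
  then show False using odd_card_field by simp
qed

lemma one_neq_minus_one: "(1::'k) \<noteq> -1" "(-1::'k) \<noteq> 1"
  using two_neq_0 by (metis add.right_inverse one_add_one)+

lemma coherent_iff:
  assumes "x \<in> \<Phi>" "y \<in> \<Phi>" "z \<in> \<Phi>" "x \<noteq> y" "y \<noteq> z" "z \<noteq> x"
  shows "{x, y, z} \<in> coherent_triples form \<beta> \<Phi> \<longleftrightarrow> nform x y * nform y z * nform z x = -1"
proof -
  have "nform x y * nform y z * nform z x = form x y * form y z * form z x / \<beta> ^ 3"
    by (simp add: nform_def power3_eq_cube)
  then show ?thesis
    using coherent_triples_iff[of form, OF form_sym assms, of \<beta>] \<beta>(1) by (simp add: divide_eq_eq)
qed

lemma \<Gamma>_subset: "\<Gamma> \<subseteq> \<Phi>"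
  using max_incoherent by (simp add: max_incoherent_def incoherent_def)

lemma finite_\<Gamma>: "finite \<Gamma>"
  using \<Gamma>_subset finite_\<Phi> finite_subset by blast

lemma no_coherent:
  assumes "x \<in> \<Gamma>" "y \<in> \<Gamma>" "z \<in> \<Gamma>" "x \<noteq> y" "y \<noteq> z" "z \<noteq> x"
  shows "{x, y, z} \<notin> coherent_triples form \<beta> \<Phi>"
proof -
  have "card {x, y, z} \<le> card \<Gamma>" using finite_\<Gamma> assms by (intro card_mono) auto
  then have "\<not> card \<Gamma> \<le> 2" using assms by auto
  then have "\<forall>t\<in>coherent_triples form \<beta> \<Phi>. \<not> t \<subseteq> \<Gamma>"
    using max_incoherent by (auto simp: max_incoherent_def incoherent_def)
  moreover have "{x, y, z} \<subseteq> \<Gamma>" using assms by simp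
  ultimately show ?thesis by metis
qed

lemma splitsD:
  assumes "\<gamma> \<in> \<Phi> - \<Gamma>"
  shows "\<Gamma>\<^sub>1 \<gamma> \<noteq> {}" "\<Gamma>\<^sub>2 \<gamma> \<noteq> {}" "\<Gamma>\<^sub>1 \<gamma> \<subseteq> \<Gamma>" "\<Gamma>\<^sub>2 \<gamma> = \<Gamma> - \<Gamma>\<^sub>1 \<gamma>"
    and "\<And>x y. x \<in> \<Gamma> \<Longrightarrow> y \<in> \<Gamma> \<Longrightarrow> x \<noteq> y \<Longrightarrow>
      {\<gamma>, x, y} \<in> coherent_triples form \<beta> \<Phi> \<longleftrightarrow> (x \<in> \<Gamma>\<^sub>1 \<gamma>) \<noteq> (y \<in> \<Gamma>\<^sub>1 \<gamma>)"
  using splits[OF assms] unfolding splits_def by blast+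

lemma g_pos:
  assumes "\<gamma> \<in> \<Phi> - \<Gamma>"
  shows "g\<^sub>1 > 0" "g\<^sub>2 > 0" "g\<^sub>1 \<le> g\<^sub>2" "card (\<Gamma>\<^sub>2 \<gamma>) = g\<^sub>2"
proof -
  have fin: "finite (\<Gamma>\<^sub>1 \<gamma>)" "finite (\<Gamma>\<^sub>2 \<gamma>)"
    using splitsD(3,4)[OF assms] finite_\<Gamma> finite_subset by auto
  have "card (\<Gamma>\<^sub>2 \<gamma>) = card \<Gamma> - g\<^sub>1"
    using splitsD(3,4)[OF assms] fin g\<^sub>1[OF assms] by (simp add: card_Diff_subset)
  then show c: "card (\<Gamma>\<^sub>2 \<gamma>) = g\<^sub>2" using g\<^sub>2 by simp
  show "g\<^sub>1 > 0" using fin splitsD(1)[OF assms] g\<^sub>1[OF assms] by auto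
  show "g\<^sub>2 > 0" using fin splitsD(2)[OF assms] c by auto
  show "g\<^sub>1 \<le> g\<^sub>2" using splits[OF assms] g\<^sub>1[OF assms] c by (simp add: splits_def)
qed

text \<open>A base point of \<Gamma> serves as reference: \<sigma> records the products with it, and
  incoherence of the triples through it forces \<open>nform x y = \<sigma> x * \<sigma> y\<close>.
  For \<gamma> outside \<Gamma> one point \<open>z\<close> of
  \<open>\<Gamma>\<^sub>1 \<gamma>\<close> fixes the sign \<open>\<tau> \<gamma>\<close>; coherence
  of the triples through \<gamma> and \<open>z\<close> then gives the remaining signs.\<close>

lemma switching_exists:
  obtains \<sigma> \<tau> :: "'v \<Rightarrow> 'k" where
    "\<And>x. x \<in> \<Gamma> \<Longrightarrow> \<sigma> x = 1 \<or> \<sigma> x = -1"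
    "\<And>x y. x \<in> \<Gamma> \<Longrightarrow> y \<in> \<Gamma> \<Longrightarrow> x \<noteq> y \<Longrightarrow> nform x y = \<sigma> x * \<sigma> y"
    "\<And>\<gamma>. \<gamma> \<in> \<Phi> - \<Gamma> \<Longrightarrow> \<tau> \<gamma> = 1 \<or> \<tau> \<gamma> = -1"
    "\<And>\<gamma> x. \<gamma> \<in> \<Phi> - \<Gamma> \<Longrightarrow> x \<in> \<Gamma> \<Longrightarrow> nform \<gamma> x = \<tau> \<gamma> * \<sigma> x * (if x \<in> \<Gamma>\<^sub>1 \<gamma> then -1 else 1)"
proof -
  obtain \<sigma> :: "'v \<Rightarrow> 'k" where \<sigma>: "\<And>x. x \<in> \<Gamma> \<Longrightarrow> \<sigma> x = 1 \<or> \<sigma> x = -1"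
    and nf: "\<And>x y. x \<in> \<Gamma> \<Longrightarrow> y \<in> \<Gamma> \<Longrightarrow> x \<noteq> y \<Longrightarrow> nform x y = \<sigma> x * \<sigma> y"
  proof (cases "\<Gamma> = {}")
    case True
    then show ?thesis using that by blast
  next
    case False
    then obtain o' where o': "o' \<in> \<Gamma>" by blast
    define \<sigma> where "\<sigma> x = (if x = o' then 1 else nform o' x)" for x
    have s: "\<sigma> x = 1 \<or> \<sigma> x = -1" if "x \<in> \<Gamma>" for x
      using that o' nform_cases[of o' x] \<Gamma>_subset by (auto simp: \<sigma>_def)
    have "nform x y = \<sigma> x * \<sigma> y" if xy: "x \<in> \<Gamma>" "y \<in> \<Gamma>" "x \<noteq> y" for x y
    proof -
      consider "x = o'" | "y = o'" | "x \<noteq> o'" "y \<noteq> o'" by blast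
      then show ?thesis
      proof cases
        case 1
        then show ?thesis using xy by (simp add: \<sigma>_def)
      next
        case 2
        then show ?thesis using xy nform_sym by (simp add: \<sigma>_def)
      next
        case 3
        have mem: "o' \<in> \<Phi>" "x \<in> \<Phi>" "y \<in> \<Phi>" using o' xy \<Gamma>_subset by auto
        have "{o', x, y} \<notin> coherent_triples form \<beta> \<Phi>" using no_coherent[of o' x y] o' xy 3 by auto
        moreover have "{o', x, y} \<in> coherent_triples form \<beta> \<Phi> \<longleftrightarrow> \<sigma> x * nform x y * \<sigma> y = -1"
          using coherent_iff[of o' x y] mem xy 3 nform_sym[of y o'] by (simp add: \<sigma>_def)
        ultimately have "\<sigma> x * nform x y * \<sigma> y \<noteq> -1" by simp
        moreover have "nform x y = 1 \<or> nform x y = -1" using nform_cases mem xy by blast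
        ultimately show ?thesis using s[OF xy(1)] s[OF xy(2)] by (elim disjE) simp_all
      qed
    qed
    with s show ?thesis using that by blast
  qed
  have "\<exists>t. (t = 1 \<or> t = -1) \<and> (\<forall>x\<in>\<Gamma>. nform \<gamma> x = t * \<sigma> x * (if x \<in> \<Gamma>\<^sub>1 \<gamma> then -1 else 1))"
    if \<gamma>: "\<gamma> \<in> \<Phi> - \<Gamma>" for \<gamma>
  proof -
    obtain z where z: "z \<in> \<Gamma>\<^sub>1 \<gamma>" "z \<in> \<Gamma>" using splitsD(1,3)[OF \<gamma>] by blast
    \<comment> \<open>The minus sign makes the sign vector of \<gamma> equal -1 at \<open>z\<close>,
      hence on all of \<open>\<Gamma>\<^sub>1 \<gamma>\<close>.\<close>
    define t where "t = - (\<sigma> z * nform \<gamma> z)"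
    have nz: "nform \<gamma> z = 1 \<or> nform \<gamma> z = -1" using nform_cases[of \<gamma> z] \<gamma> z \<Gamma>_subset by auto
    have t: "t = 1 \<or> t = -1" using \<sigma>[OF z(2)] nz by (auto simp: t_def)
    have "nform \<gamma> x = t * \<sigma> x * (if x \<in> \<Gamma>\<^sub>1 \<gamma> then -1 else 1)" if x: "x \<in> \<Gamma>" for x
    proof (cases "x = z")
      case True
      then show ?thesis using z \<sigma>[OF z(2)] by (auto simp: t_def)
    next
      case False
      have nx: "nform \<gamma> x = 1 \<or> nform \<gamma> x = -1" using nform_cases[of \<gamma> x] \<gamma> x \<Gamma>_subset by auto
      have "{\<gamma>, z, x} \<in> coherent_triples form \<beta> \<Phi> \<longleftrightarrow> nform \<gamma> z * (\<sigma> z * \<sigma> x) * nform \<gamma> x = -1"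
        using coherent_iff[of \<gamma> z x] \<gamma> z x False \<Gamma>_subset nf[OF z(2) x] nform_sym[of x \<gamma>] by auto
      then have "x \<notin> \<Gamma>\<^sub>1 \<gamma> \<longleftrightarrow> nform \<gamma> z * (\<sigma> z * \<sigma> x) * nform \<gamma> x = -1"
        using splitsD(5)[OF \<gamma> z(2) x] False z by auto
      then show ?thesis
        using nx nz \<sigma>[OF z(2)] \<sigma>[OF x] one_neq_minus_one unfolding t_def
        by (elim disjE) simp_all
    qed
    with t show ?thesis by blast
  qed
  then obtain \<tau> where "\<And>\<gamma>. \<gamma> \<in> \<Phi> - \<Gamma> \<Longrightarrow> (\<tau> \<gamma> = 1 \<or> \<tau> \<gamma> = -1) \<and>
      (\<forall>x\<in>\<Gamma>. nform \<gamma> x = \<tau> \<gamma> * \<sigma> x * (if x \<in> \<Gamma>\<^sub>1 \<gamma> then -1 else 1))"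
    by metis
  then show ?thesis using that[of \<sigma> \<tau>] \<sigma> nf by blast
qed

section \<open>Products of vectors outside the basis\<close>

lemma sum_signs:
  assumes "\<gamma> \<in> \<Phi> - \<Gamma>"
  shows "(\<Sum>x\<in>\<Gamma>. if x \<in> \<Gamma>\<^sub>1 \<gamma> then -1 else 1) = (of_nat g\<^sub>2 - of_nat g\<^sub>1 :: 'k)"
proof -
  have "(\<Sum>x\<in>\<Gamma>. if x \<in> \<Gamma>\<^sub>1 \<gamma> then -1 else 1)
      = (\<Sum>x\<in>\<Gamma> \<inter> \<Gamma>\<^sub>1 \<gamma>. -1) + (\<Sum>x\<in>\<Gamma> \<inter> - \<Gamma>\<^sub>1 \<gamma>. 1 :: 'k)"
    using finite_\<Gamma> by (simp add: sum.If_cases)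
  also have "\<Gamma> \<inter> \<Gamma>\<^sub>1 \<gamma> = \<Gamma>\<^sub>1 \<gamma>" using splitsD(3)[OF assms] by blast
  also have "\<Gamma> \<inter> - \<Gamma>\<^sub>1 \<gamma> = \<Gamma>\<^sub>2 \<gamma>" using splitsD(4)[OF assms] by blast
  finally show ?thesis using g\<^sub>1[OF assms] g_pos(4)[OF assms] by simp
qed

lemma sum_signs_product:
  assumes "\<gamma> \<in> \<Phi> - \<Gamma>" "\<gamma>' \<in> \<Phi> - \<Gamma>"
  shows "(\<Sum>x\<in>\<Gamma>. (if x \<in> \<Gamma>\<^sub>1 \<gamma> then -1 else 1) * (if x \<in> \<Gamma>\<^sub>1 \<gamma>' then -1 else 1))
    = (of_nat (card \<Gamma>) - 4 * of_nat g\<^sub>1 + 4 * of_nat (card (\<Gamma>\<^sub>1 \<gamma> \<inter> \<Gamma>\<^sub>1 \<gamma>')) :: 'k)"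
proof -
  have c: "(\<Sum>x\<in>\<Gamma>. of_bool (x \<in> A)) = (of_nat (card A) :: 'k)" if "A \<subseteq> \<Gamma>" for A
    using card_Collect_eq_sum[OF finite_\<Gamma>, of "\<lambda>x. x \<in> A", where 'a='k] that
    by (simp add: Collect_conj_eq Int_absorb1)
  have "(\<Sum>x\<in>\<Gamma>. (if x \<in> \<Gamma>\<^sub>1 \<gamma> then -1 else 1) * (if x \<in> \<Gamma>\<^sub>1 \<gamma>' then -1 else 1))
    = (\<Sum>x\<in>\<Gamma>. 1 - 2 * of_bool (x \<in> \<Gamma>\<^sub>1 \<gamma>) - 2 * of_bool (x \<in> \<Gamma>\<^sub>1 \<gamma>')
        + 4 * of_bool (x \<in> \<Gamma>\<^sub>1 \<gamma> \<inter> \<Gamma>\<^sub>1 \<gamma>') :: 'k)"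
    by (intro sum.cong refl) auto
  also have "\<dots> = of_nat (card \<Gamma>) - 2 * of_nat g\<^sub>1 - 2 * of_nat g\<^sub>1
      + 4 * of_nat (card (\<Gamma>\<^sub>1 \<gamma> \<inter> \<Gamma>\<^sub>1 \<gamma>'))"
    using c[OF splitsD(3)[OF assms(1)]] c[OF splitsD(3)[OF assms(2)]] c[of "\<Gamma>\<^sub>1 \<gamma> \<inter> \<Gamma>\<^sub>1 \<gamma>'"]
      splitsD(3)[OF assms(1)] g\<^sub>1[OF assms(1)] g\<^sub>1[OF assms(2)]
    by (simp only: sum.distrib sum_subtractf sum_distrib_left[symmetric]) (simp add: le_infI1)
  finally show ?thesis by (simp add: algebra_simps)
qed

text \<open>Expanding \<open>\<gamma>\<close> in the basis \<open>\<Gamma>\<close> expresses all products of vectors outside \<open>\<Gamma>\<close> through the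
  sign vectors; the sum \<open>C\<close> of the coefficients is eliminated by means of \<open>\<langle>\<gamma>,\<gamma>\<rangle>\<close>.\<close>

lemma gram_outside:
  obtains \<tau> :: "'v \<Rightarrow> 'k" where
    "\<And>\<gamma>. \<gamma> \<in> \<Phi> - \<Gamma> \<Longrightarrow> \<tau> \<gamma> = 1 \<or> \<tau> \<gamma> = -1"
    "\<And>\<gamma> \<gamma>'. \<gamma> \<in> \<Phi> - \<Gamma> \<Longrightarrow> \<gamma>' \<in> \<Phi> - \<Gamma> \<Longrightarrow> 4 * of_nat (card (\<Gamma>\<^sub>1 \<gamma> \<inter> \<Gamma>\<^sub>1 \<gamma>'))
        = 4 * of_nat g\<^sub>1 - \<rho> * (\<rho> - 1) + (\<rho> - 1) * (\<tau> \<gamma> * \<tau> \<gamma>' * nform \<gamma> \<gamma>')"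
    "\<And>\<gamma>. \<gamma> \<in> \<Phi> - \<Gamma> \<Longrightarrow> g\<^sub>1 = g\<^sub>2 \<Longrightarrow> \<rho> * (\<rho> - 1) = of_nat (card \<Gamma>)"
proof -
  obtain \<sigma> \<tau> :: "'v \<Rightarrow> 'k" where \<sigma>: "\<And>x. x \<in> \<Gamma> \<Longrightarrow> \<sigma> x = 1 \<or> \<sigma> x = -1"
    and in\<Gamma>: "\<And>x y. x \<in> \<Gamma> \<Longrightarrow> y \<in> \<Gamma> \<Longrightarrow> x \<noteq> y \<Longrightarrow> nform x y = \<sigma> x * \<sigma> y"
    and \<tau>: "\<And>\<gamma>. \<gamma> \<in> \<Phi> - \<Gamma> \<Longrightarrow> \<tau> \<gamma> = 1 \<or> \<tau> \<gamma> = -1"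
    and out: "\<And>\<gamma> x. \<gamma> \<in> \<Phi> - \<Gamma> \<Longrightarrow> x \<in> \<Gamma> \<Longrightarrow>
      nform \<gamma> x = \<tau> \<gamma> * \<sigma> x * (if x \<in> \<Gamma>\<^sub>1 \<gamma> then -1 else 1)"
    by (rule switching_exists) blast
  define \<epsilon> where "\<epsilon> \<gamma> x = (if x \<in> \<Gamma>\<^sub>1 \<gamma> then -1 else 1 :: 'k)" for \<gamma> x
  define D where "D = (of_nat g\<^sub>2 - of_nat g\<^sub>1 :: 'k)"
  \<comment> \<open>The constant \<open>C\<close> depends on \<gamma> but not on
    \<open>\<gamma>'\<close>. This is what allows \<open>C * D\<close> to be read off from the
    choice \<open>\<gamma>' = \<gamma>\<close> and inserted for every other
    \<open>\<gamma>'\<close>.\<close>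
  have expand: "\<exists>C. \<forall>\<gamma>'\<in>\<Phi> - \<Gamma>. (\<rho> - 1) * (\<tau> \<gamma> * \<tau> \<gamma>' * nform \<gamma> \<gamma>')
      = (\<Sum>x\<in>\<Gamma>. \<epsilon> \<gamma> x * \<epsilon> \<gamma>' x) - C * D" if \<gamma>: "\<gamma> \<in> \<Phi> - \<Gamma>" for \<gamma>
  proof -
    have "UNIV \<subseteq> span \<Gamma>"
      by (rule card_ge_dim_independent) (use independent card_\<Gamma> in auto)
    then obtain u where u: "\<gamma> = (\<Sum>x\<in>\<Gamma>. scale (u x) x)"
      using span_finite[OF finite_\<Gamma>] by auto
    \<comment> \<open>These are the coordinates of the switched vector
      \<open>\<tau> \<gamma>\<close> times \<gamma> in the switched basis of vectors
      \<open>\<sigma> x\<close> times \<open>x\<close>.\<close>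
    define c where "c x = \<tau> \<gamma> * \<sigma> x * u x" for x
    define C where "C = (\<Sum>x\<in>\<Gamma>. c x)"
    have nf\<gamma>: "nform y \<gamma> = (\<Sum>x\<in>\<Gamma>. u x * nform y x)" for y
      unfolding u nform_sum nform_scale by simp
    \<comment> \<open>Pairing with the switched basis vector at \<open>y\<close> adds up all
      coordinates, which gives \<open>C\<close>; the diagonal entry \<rho> in place of 1 contributes
      the extra \<open>(\<rho> - 1) * c y\<close>.\<close>
    have coeff: "(\<rho> - 1) * c y = \<epsilon> \<gamma> y - C" if y: "y \<in> \<Gamma>" for y
    proof -
      have "\<epsilon> \<gamma> y = \<tau> \<gamma> * (\<sigma> y * nform y \<gamma>)"
        using out[OF \<gamma> y] nform_sym[of y \<gamma>] \<sigma>[OF y] \<tau>[OF \<gamma>] unfolding \<epsilon>_def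
        by (elim disjE) simp_all
      also have "\<dots> = (\<Sum>x\<in>\<Gamma>. \<tau> \<gamma> * (\<sigma> y * (u x * nform y x)))"
        unfolding nf\<gamma> by (simp add: sum_distrib_left)
      also have "\<dots> = (\<Sum>x\<in>\<Gamma>. c x + (if x = y then (\<rho> - 1) * c y else 0))"
      proof (intro sum.cong refl)
        fix x assume x: "x \<in> \<Gamma>"
        show "\<tau> \<gamma> * (\<sigma> y * (u x * nform y x)) = c x + (if x = y then (\<rho> - 1) * c y else 0)"
        proof (cases "x = y")
          case True
          then show ?thesis using nform_self[of y] y \<Gamma>_subset by (auto simp: c_def algebra_simps)
        next
          case False
          then have "nform y x = \<sigma> y * \<sigma> x" using in\<Gamma>[OF y x] by simp
          then show ?thesis using False \<sigma>[OF y] by (auto simp: c_def algebra_simps)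
        qed
      qed
      also have "\<dots> = C + (\<rho> - 1) * c y"
        using y finite_\<Gamma> by (simp add: sum.distrib C_def)
      finally show ?thesis by (simp add: algebra_simps)
    qed
    have "(\<rho> - 1) * (\<tau> \<gamma> * \<tau> \<gamma>' * nform \<gamma> \<gamma>') = (\<Sum>x\<in>\<Gamma>. \<epsilon> \<gamma> x * \<epsilon> \<gamma>' x) - C * D"
      if \<gamma>': "\<gamma>' \<in> \<Phi> - \<Gamma>" for \<gamma>'
    proof -
      have "\<tau> \<gamma> * \<tau> \<gamma>' * nform \<gamma> \<gamma>' = (\<Sum>x\<in>\<Gamma>. \<tau> \<gamma> * \<tau> \<gamma>' * (u x * nform \<gamma>' x))"
        unfolding nform_sym[of \<gamma> \<gamma>'] nf\<gamma> by (simp add: sum_distrib_left)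
      also have "\<dots> = (\<Sum>x\<in>\<Gamma>. c x * \<epsilon> \<gamma>' x)"
        using out[OF \<gamma>'] \<tau>[OF \<gamma>'] by (intro sum.cong refl) (auto simp: c_def \<epsilon>_def)
      finally have "(\<rho> - 1) * (\<tau> \<gamma> * \<tau> \<gamma>' * nform \<gamma> \<gamma>') = (\<Sum>x\<in>\<Gamma>. (\<rho> - 1) * c x * \<epsilon> \<gamma>' x)"
        by (simp add: sum_distrib_left mult.assoc)
      also have "\<dots> = (\<Sum>x\<in>\<Gamma>. \<epsilon> \<gamma> x * \<epsilon> \<gamma>' x - C * \<epsilon> \<gamma>' x)"
        using coeff by (intro sum.cong refl) (simp add: left_diff_distrib)
      also have "\<dots> = (\<Sum>x\<in>\<Gamma>. \<epsilon> \<gamma> x * \<epsilon> \<gamma>' x) - C * D"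
        using sum_signs[OF \<gamma>'] by (simp add: sum_subtractf sum_distrib_left[symmetric] \<epsilon>_def D_def)
      finally show ?thesis .
    qed
    then show ?thesis by blast
  qed
  have prod: "(\<Sum>x\<in>\<Gamma>. \<epsilon> \<gamma> x * \<epsilon> \<gamma>' x)
      = of_nat (card \<Gamma>) - 4 * of_nat g\<^sub>1 + 4 * of_nat (card (\<Gamma>\<^sub>1 \<gamma> \<inter> \<Gamma>\<^sub>1 \<gamma>'))"
    if "\<gamma> \<in> \<Phi> - \<Gamma>" "\<gamma>' \<in> \<Phi> - \<Gamma>" for \<gamma> \<gamma>'
    unfolding \<epsilon>_def by (rule sum_signs_product[OF that])
  have self: "\<tau> \<gamma> * \<tau> \<gamma> * nform \<gamma> \<gamma> = \<rho>" if "\<gamma> \<in> \<Phi> - \<Gamma>" for \<gamma>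
    using that nform_self[of \<gamma>] \<tau>[OF that] by auto
  show thesis
  proof (rule that[of \<tau>])
    fix \<gamma> assume "\<gamma> \<in> \<Phi> - \<Gamma>"
    then show "\<tau> \<gamma> = 1 \<or> \<tau> \<gamma> = -1" by (rule \<tau>)
  next
    fix \<gamma> \<gamma>' assume \<gamma>: "\<gamma> \<in> \<Phi> - \<Gamma>" and \<gamma>': "\<gamma>' \<in> \<Phi> - \<Gamma>"
    obtain C where C: "\<forall>\<gamma>'\<in>\<Phi> - \<Gamma>. (\<rho> - 1) * (\<tau> \<gamma> * \<tau> \<gamma>' * nform \<gamma> \<gamma>')
      = (\<Sum>x\<in>\<Gamma>. \<epsilon> \<gamma> x * \<epsilon> \<gamma>' x) - C * D" using expand[OF \<gamma>] by blast
    have "(\<rho> - 1) * \<rho> = of_nat (card \<Gamma>) - C * D"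
      using bspec[OF C \<gamma>] unfolding prod[OF \<gamma> \<gamma>] self[OF \<gamma>] using g\<^sub>1[OF \<gamma>] by simp
    then have "C * D = of_nat (card \<Gamma>) - \<rho> * (\<rho> - 1)" by (simp add: algebra_simps)
    then show "4 * of_nat (card (\<Gamma>\<^sub>1 \<gamma> \<inter> \<Gamma>\<^sub>1 \<gamma>'))
        = 4 * of_nat g\<^sub>1 - \<rho> * (\<rho> - 1) + (\<rho> - 1) * (\<tau> \<gamma> * \<tau> \<gamma>' * nform \<gamma> \<gamma>')"
      using bspec[OF C \<gamma>'] unfolding prod[OF \<gamma> \<gamma>'] by (simp only:) simp
  next
    \<comment> \<open>For parts of equal size the sign vectors sum to zero, so \<open>D = 0\<close>
      and the unknown \<open>C\<close> disappears.\<close>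
    fix \<gamma> assume \<gamma>: "\<gamma> \<in> \<Phi> - \<Gamma>" and g: "g\<^sub>1 = g\<^sub>2"
    obtain C where C: "\<forall>\<gamma>'\<in>\<Phi> - \<Gamma>. (\<rho> - 1) * (\<tau> \<gamma> * \<tau> \<gamma>' * nform \<gamma> \<gamma>')
      = (\<Sum>x\<in>\<Gamma>. \<epsilon> \<gamma> x * \<epsilon> \<gamma>' x) - C * D" using expand[OF \<gamma>] by blast
    show "\<rho> * (\<rho> - 1) = of_nat (card \<Gamma>)"
      using bspec[OF C \<gamma>] unfolding prod[OF \<gamma> \<gamma>] self[OF \<gamma>] using g\<^sub>1[OF \<gamma>] g
      by (simp add: D_def mult.commute)
  qed
qed

section \<open>Intersection sizes of blocks and the field element \<rho>\<close>

lemma four_neq_0: "(4::'k) \<noteq> 0"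
proof -
  have "(2::'k) * 2 \<noteq> 0" by (rule no_zero_divisors[OF two_neq_0 two_neq_0])
  then show ?thesis by simp
qed

lemma uniform_blocks_\<Gamma>\<^sub>1: "uniform_blocks (\<Phi> - \<Gamma>) \<Gamma> \<Gamma>\<^sub>1 g\<^sub>1"
  using finite_\<Phi> finite_\<Gamma> splitsD(3) g\<^sub>1 by unfold_locales auto

lemma uniform_blocks_\<Gamma>\<^sub>2: "uniform_blocks (\<Phi> - \<Gamma>) \<Gamma> \<Gamma>\<^sub>2 g\<^sub>2"
  using finite_\<Phi> finite_\<Gamma> splitsD(4) g_pos(4) by unfold_locales auto

lemma card_\<Phi>_eq: "card \<Phi> = card \<Gamma> + card (\<Phi> - \<Gamma>)"
  using card_Un_disjoint[of \<Gamma> "\<Phi> - \<Gamma>"] finite_\<Gamma> finite_\<Phi> \<Gamma>_subset by (simp add: Un_absorb1)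

text \<open>A coherent triple through two points of \<Gamma> cannot lie in \<Gamma>, so its third
  point is outside. By the defining property of the splitting, the possible third points are exactly
  those whose parts separate \<open>x\<close> and \<open>y\<close>.\<close>

lemma card_separating:
  assumes xy: "x \<in> \<Gamma>" "y \<in> \<Gamma>" "x \<noteq> y"
  shows "card {\<gamma> \<in> \<Phi> - \<Gamma>. (x \<in> \<Gamma>\<^sub>1 \<gamma>) \<noteq> (y \<in> \<Gamma>\<^sub>1 \<gamma>)}
    = card {t \<in> coherent_triples form \<beta> \<Phi>. {x, y} \<subseteq> t}"
proof -
  let ?A = "{\<gamma> \<in> \<Phi> - \<Gamma>. (x \<in> \<Gamma>\<^sub>1 \<gamma>) \<noteq> (y \<in> \<Gamma>\<^sub>1 \<gamma>)}"
  have image: "{t \<in> coherent_triples form \<beta> \<Phi>. {x, y} \<subseteq> t} = (\<lambda>\<gamma>. {\<gamma>, x, y}) ` ?A"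
  proof (intro equalityI subsetI)
    fix t assume t: "t \<in> {t \<in> coherent_triples form \<beta> \<Phi>. {x, y} \<subseteq> t}"
    then obtain u v w where uvw: "t = {u, v, w}" "u \<in> \<Phi>" "v \<in> \<Phi>" "w \<in> \<Phi>" "u \<noteq> v" "v \<noteq> w" "w \<noteq> u"
      unfolding coherent_triples_def by blast
    have "\<exists>z. t = {z, x, y} \<and> z \<in> \<Phi> \<and> z \<noteq> x \<and> z \<noteq> y"
    proof -
      have "x \<in> {u, v, w}" "y \<in> {u, v, w}" using t uvw(1) by auto
      then have "(x = u \<and> y = v) \<or> (x = u \<and> y = w) \<or> (x = v \<and> y = u) \<or> (x = v \<and> y = w)
          \<or> (x = w \<and> y = u) \<or> (x = w \<and> y = v)" using xy(3) by blast
      then show ?thesis using uvw by (elim disjE) (auto simp: insert_commute)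
    qed
    then obtain z where z: "t = {z, x, y}" "z \<in> \<Phi>" "z \<noteq> x" "z \<noteq> y" by blast
    then have "z \<notin> \<Gamma>" using no_coherent[of z x y] xy t by auto
    then have "z \<in> ?A" using splitsD(5)[of z x y] z xy t by auto
    then show "t \<in> (\<lambda>\<gamma>. {\<gamma>, x, y}) ` ?A" using z(1) by blast
  next
    fix t assume "t \<in> (\<lambda>\<gamma>. {\<gamma>, x, y}) ` ?A"
    then obtain \<gamma> where "\<gamma> \<in> ?A" "t = {\<gamma>, x, y}" by blast
    then show "t \<in> {t \<in> coherent_triples form \<beta> \<Phi>. {x, y} \<subseteq> t}"
      using splitsD(5)[of \<gamma> x y] xy by auto
  qed
  have "inj_on (\<lambda>\<gamma>. {\<gamma>, x, y}) ?A"
  proof (rule inj_onI)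
    fix \<gamma> \<gamma>' assume "\<gamma> \<in> ?A" "\<gamma>' \<in> ?A" "{\<gamma>, x, y} = {\<gamma>', x, y}"
    then have "\<gamma> \<in> {\<gamma>', x, y}" "\<gamma> \<notin> \<Gamma>" by auto
    then show "\<gamma> = \<gamma>'" using xy by auto
  qed
  then show ?thesis unfolding image by (rule card_image[symmetric])
qed

text \<open>Origin of the two residues: \<open>\<rho> * (\<rho> - 1) - (\<rho> - 1) * t\<close> is
  \<open>(\<rho> - 1)\<^sup>2\<close> for \<open>t = 1\<close> and \<open>\<rho>\<^sup>2 - 1\<close>
  for \<open>t = -1\<close>.\<close>

lemma intersection_of_sign:
  assumes "4 * of_nat s = 4 * of_nat g\<^sub>1 - \<rho> * (\<rho> - 1) + (\<rho> - 1) * t"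
  shows "t = 1 \<Longrightarrow> of_nat s = of_nat g\<^sub>1 - (\<rho> - 1)\<^sup>2 / 4"
    and "t = -1 \<Longrightarrow> of_nat s = of_nat g\<^sub>1 - (\<rho>\<^sup>2 - 1) / 4"
  using assms four_neq_0 by (simp_all add: field_simps power2_eq_square)

lemma intersection_cases:
  assumes "\<gamma> \<in> \<Phi> - \<Gamma>" "\<gamma>' \<in> \<Phi> - \<Gamma>" "\<gamma> \<noteq> \<gamma>'"
  shows "smallest_nat_equiv (of_nat g\<^sub>1 - (\<rho> - 1)\<^sup>2 / 4) (card (\<Gamma>\<^sub>1 \<gamma> \<inter> \<Gamma>\<^sub>1 \<gamma>')) \<or>
    smallest_nat_equiv (of_nat g\<^sub>1 - (\<rho>\<^sup>2 - 1) / 4) (card (\<Gamma>\<^sub>1 \<gamma> \<inter> \<Gamma>\<^sub>1 \<gamma>'))"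
proof -
  obtain \<tau> :: "'v \<Rightarrow> 'k" where \<tau>: "\<And>\<gamma>. \<gamma> \<in> \<Phi> - \<Gamma> \<Longrightarrow> \<tau> \<gamma> = 1 \<or> \<tau> \<gamma> = -1"
    and gram: "\<And>\<gamma> \<gamma>'. \<gamma> \<in> \<Phi> - \<Gamma> \<Longrightarrow> \<gamma>' \<in> \<Phi> - \<Gamma> \<Longrightarrow> 4 * of_nat (card (\<Gamma>\<^sub>1 \<gamma> \<inter> \<Gamma>\<^sub>1 \<gamma>'))
        = 4 * of_nat g\<^sub>1 - \<rho> * (\<rho> - 1) + (\<rho> - 1) * (\<tau> \<gamma> * \<tau> \<gamma>' * nform \<gamma> \<gamma>')"
    by (rule gram_outside) blast
  have "\<tau> \<gamma> * \<tau> \<gamma>' * nform \<gamma> \<gamma>' = 1 \<or> \<tau> \<gamma> * \<tau> \<gamma>' * nform \<gamma> \<gamma>' = -1"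
    using \<tau>[OF assms(1)] \<tau>[OF assms(2)] nform_cases[of \<gamma> \<gamma>'] assms by auto
  then have "of_nat (card (\<Gamma>\<^sub>1 \<gamma> \<inter> \<Gamma>\<^sub>1 \<gamma>')) = of_nat g\<^sub>1 - (\<rho> - 1)\<^sup>2 / 4 \<or>
      of_nat (card (\<Gamma>\<^sub>1 \<gamma> \<inter> \<Gamma>\<^sub>1 \<gamma>')) = of_nat g\<^sub>1 - (\<rho>\<^sup>2 - 1) / 4"
    using intersection_of_sign[OF gram[OF assms(1,2)]] by blast
  moreover have "card (\<Gamma>\<^sub>1 \<gamma> \<inter> \<Gamma>\<^sub>1 \<gamma>') \<le> card \<Gamma>"
    using splitsD(3)[OF assms(1)] finite_\<Gamma> by (intro card_mono) auto
  ultimately show ?thesis using char smallest_nat_equivI[where 'k='k] by auto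
qed

text \<open>If both signs occur among the products outside \<open>\<Gamma>\<close>, then two intersection sizes determine
  \<open>\<rho>\<close>; otherwise the Gram matrix \<open>(\<rho> - t)I + tJ\<close> of more than \<open>dim V\<close> vectors is singular.\<close>

lemma \<rho>_in_prime_field:
  assumes "card (\<Phi> - \<Gamma>) > card \<Gamma>"
  shows "\<exists>z::int. \<rho> = of_int z"
proof -
  obtain \<tau> :: "'v \<Rightarrow> 'k" where \<tau>: "\<And>\<gamma>. \<gamma> \<in> \<Phi> - \<Gamma> \<Longrightarrow> \<tau> \<gamma> = 1 \<or> \<tau> \<gamma> = -1"
    and gram: "\<And>\<gamma> \<gamma>'. \<gamma> \<in> \<Phi> - \<Gamma> \<Longrightarrow> \<gamma>' \<in> \<Phi> - \<Gamma> \<Longrightarrow> 4 * of_nat (card (\<Gamma>\<^sub>1 \<gamma> \<inter> \<Gamma>\<^sub>1 \<gamma>'))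
        = 4 * of_nat g\<^sub>1 - \<rho> * (\<rho> - 1) + (\<rho> - 1) * (\<tau> \<gamma> * \<tau> \<gamma>' * nform \<gamma> \<gamma>')"
    by (rule gram_outside) blast
  define n' where "n' \<gamma> \<gamma>' = \<tau> \<gamma> * \<tau> \<gamma>' * nform \<gamma> \<gamma>'" for \<gamma> \<gamma>'
  let ?I = "\<Phi> - \<Gamma>"
  have sgn: "n' \<gamma> \<gamma>' = 1 \<or> n' \<gamma> \<gamma>' = -1" if "\<gamma> \<in> ?I" "\<gamma>' \<in> ?I" "\<gamma> \<noteq> \<gamma>'" for \<gamma> \<gamma>'
    using \<tau>[OF that(1)] \<tau>[OF that(2)] nform_cases[of \<gamma> \<gamma>'] that by (auto simp: n'_def)
  show ?thesis
  proof (cases "\<exists>\<gamma>\<in>?I. \<exists>\<gamma>'\<in>?I. \<exists>\<delta>\<in>?I. \<exists>\<delta>'\<in>?I. n' \<gamma> \<gamma>' = 1 \<and> n' \<delta> \<delta>' = -1")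
    case True
    then obtain \<gamma> \<gamma>' \<delta> \<delta>' where m: "\<gamma> \<in> ?I" "\<gamma>' \<in> ?I" "\<delta> \<in> ?I" "\<delta>' \<in> ?I"
      and v: "n' \<gamma> \<gamma>' = 1" "n' \<delta> \<delta>' = -1" by blast
    define s where "s = card (\<Gamma>\<^sub>1 \<gamma> \<inter> \<Gamma>\<^sub>1 \<gamma>')"
    define s' where "s' = card (\<Gamma>\<^sub>1 \<delta> \<inter> \<Gamma>\<^sub>1 \<delta>')"
    have e: "4 * of_nat s = 4 * of_nat g\<^sub>1 - \<rho> * (\<rho> - 1) + (\<rho> - 1)"
      using gram[OF m(1,2)] v(1) by (simp add: s_def n'_def)
    have e': "4 * of_nat s' = 4 * of_nat g\<^sub>1 - \<rho> * (\<rho> - 1) - (\<rho> - 1)"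
      using gram[OF m(3,4)] v(2) by (simp add: s'_def n'_def)
    \<comment> \<open>Subtracting the relations for the two signs leaves
      \<open>4 * (s - s') = 2 * (\<rho> - 1)\<close>, which is solved for \<rho>.\<close>
    have "2 * (\<rho> - (2 * (of_nat s - of_nat s') + 1)) = 2 * (\<rho> - 1) - (4 * of_nat s - 4 * of_nat s')"
      by (simp add: algebra_simps)
    also have "\<dots> = 0" unfolding e e' by (simp add: algebra_simps)
    finally have "\<rho> - (2 * (of_nat s - of_nat s') + 1) = 0" using two_neq_0 by (auto simp only: mult_eq_0_iff)
    then have "\<rho> = of_int (2 * (int s - int s') + 1)" by simp
    then show ?thesis by blast
  next
    case False
    have "(\<forall>\<gamma>\<in>?I. \<forall>\<gamma>'\<in>?I. \<gamma> \<noteq> \<gamma>' \<longrightarrow> n' \<gamma> \<gamma>' = 1) \<or> (\<forall>\<gamma>\<in>?I. \<forall>\<gamma>'\<in>?I. \<gamma> \<noteq> \<gamma>' \<longrightarrow> n' \<gamma> \<gamma>' = -1)"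
      using sgn False by blast
    then have "\<exists>t. (t = 1 \<or> t = -1) \<and> (\<forall>\<gamma>\<in>?I. \<forall>\<gamma>'\<in>?I. \<gamma> \<noteq> \<gamma>' \<longrightarrow> n' \<gamma> \<gamma>' = t)"
      by blast
    then obtain t where t: "t = 1 \<or> t = -1"
      and const: "\<And>\<gamma> \<gamma>'. \<gamma> \<in> ?I \<Longrightarrow> \<gamma>' \<in> ?I \<Longrightarrow> \<gamma> \<noteq> \<gamma>' \<Longrightarrow> n' \<gamma> \<gamma>' = t" by blast
    have finI: "finite ?I" using finite_\<Phi> by simp
    have "dependent ?I"
    proof (rule ccontr)
      assume "\<not> dependent ?I"
      then have "card ?I \<le> dim UNIV" by (intro independent_card_le_dim) auto
      then show False using assms card_\<Gamma> by simp
    qed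
    then obtain u where u: "\<exists>v\<in>?I. u v \<noteq> 0" "(\<Sum>v\<in>?I. scale (u v) v) = 0"
      using dependent_finite[OF finI] by blast
    define x where "x v = \<tau> v * u v" for v
    define S where "S = (\<Sum>v\<in>?I. x v)"
    have row: "(\<rho> - t) * x \<gamma> + t * S = 0" if \<gamma>: "\<gamma> \<in> ?I" for \<gamma>
    proof -
      have "0 = \<tau> \<gamma> * nform \<gamma> (\<Sum>v\<in>?I. scale (u v) v)"
        using nform_scale[of \<gamma> 0 0] unfolding u(2) by simp
      also have "\<dots> = (\<Sum>v\<in>?I. \<tau> \<gamma> * (u v * nform \<gamma> v))"
        by (simp add: nform_sum nform_scale sum_distrib_left)
      also have "\<dots> = (\<Sum>v\<in>?I. t * x v + (if v = \<gamma> then (\<rho> - t) * x \<gamma> else 0))"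
      proof (intro sum.cong refl)
        fix v assume v: "v \<in> ?I"
        have e: "\<tau> \<gamma> * (u v * nform \<gamma> v) = n' \<gamma> v * x v"
          using \<tau>[OF v] by (auto simp: n'_def x_def)
        show "\<tau> \<gamma> * (u v * nform \<gamma> v) = t * x v + (if v = \<gamma> then (\<rho> - t) * x \<gamma> else 0)"
        proof (cases "v = \<gamma>")
          case True
          have "n' \<gamma> \<gamma> = \<rho>" using nform_self[of \<gamma>] \<gamma> \<tau>[OF \<gamma>] by (auto simp: n'_def)
          then show ?thesis using True e by (simp add: algebra_simps)
        next
          case False
          then show ?thesis using e const[OF \<gamma> v] by simp
        qed
      qed
      also have "\<dots> = t * S + (\<rho> - t) * x \<gamma>"
        using \<gamma> finI by (simp add: sum.distrib S_def sum_distrib_left)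
      finally show ?thesis by (simp add: add.commute)
    qed
    have nz: "\<rho> - t \<noteq> 0" using t \<rho>_neq by auto
    obtain v where v: "v \<in> ?I" "u v \<noteq> 0" using u(1) by blast
    have xv: "x v \<noteq> 0" using v \<tau>[OF v(1)] by (auto simp: x_def)
    \<comment> \<open>Every row says that \<open>(\<rho> - t) * x w\<close> equals
      \<open>- t * S\<close>, so the kernel vector is constant. A nonzero constant kernel vector
      forces \<rho> to be \<open>t - t * N\<close> with \<open>N\<close> the number of vectors
      outside \<Gamma>.\<close>
    have "x w = x v" if "w \<in> ?I" for w
    proof -
      have "(\<rho> - t) * x w = (\<rho> - t) * x v"
        using row[OF that] row[OF v(1)] by (simp only: eq_neg_iff_add_eq_0[symmetric])
      then show ?thesis using nz by simp
    qed
    then have "S = of_nat (card ?I) * x v" by (simp add: S_def)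
    then have "(\<rho> - t + t * of_nat (card ?I)) * x v = 0"
      using row[OF v(1)] by (simp add: algebra_simps)
    then have "\<rho> - t + t * of_nat (card ?I) = 0" using xv by (auto simp only: mult_eq_0_iff)
    then have "\<rho> = t - t * of_nat (card ?I)" by (simp add: algebra_simps)
    then have "\<rho> = of_int (1 - int (card ?I)) \<or> \<rho> = of_int (int (card ?I) - 1)"
      using t by auto
    then show ?thesis by blast
  qed
qed

text \<open>With \<rho> the image of an integer, both residues are integers divided by 4 and so have
  least representatives. Which of the two is smaller depends on \<rho>, hence \<open>min\<close> and
  \<open>max\<close>.\<close>

lemma quasi_symmetric_intersections:
  assumes "card (\<Phi> - \<Gamma>) > card \<Gamma>"
  shows "\<exists>s\<^sub>1 s\<^sub>2. smallest_nat_equiv (of_nat g\<^sub>1 - (\<rho> - 1)\<^sup>2 / 4) s\<^sub>1 \<and>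
      smallest_nat_equiv (of_nat g\<^sub>1 - (\<rho>\<^sup>2 - 1) / 4) s\<^sub>2 \<and>
      block_intersections (\<lambda>s. s = min s\<^sub>1 s\<^sub>2 \<or> s = max s\<^sub>1 s\<^sub>2) {#\<Gamma>\<^sub>1 \<gamma>. \<gamma> \<in># mset_set (\<Phi> - \<Gamma>)#}"
proof -
  obtain z :: int where z: "\<rho> = of_int z" using \<rho>_in_prime_field[OF assms] by blast
  have pos: "CHAR('k) > 0" using char by simp
  have e\<^sub>1: "of_nat g\<^sub>1 - (\<rho> - 1)\<^sup>2 / 4 = of_int (4 * int g\<^sub>1 - (z - 1)\<^sup>2) / (4::'k)"
    using four_neq_0 by (simp add: z field_simps)
  obtain s\<^sub>1 where s\<^sub>1: "smallest_nat_equiv (of_nat g\<^sub>1 - (\<rho> - 1)\<^sup>2 / 4) s\<^sub>1"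
    unfolding e\<^sub>1 using smallest_nat_equiv_quarter[OF pos two_neq_0] by blast
  have e\<^sub>2: "of_nat g\<^sub>1 - (\<rho>\<^sup>2 - 1) / 4 = of_int (4 * int g\<^sub>1 - (z\<^sup>2 - 1)) / (4::'k)"
    using four_neq_0 by (simp add: z field_simps)
  obtain s\<^sub>2 where s\<^sub>2: "smallest_nat_equiv (of_nat g\<^sub>1 - (\<rho>\<^sup>2 - 1) / 4) s\<^sub>2"
    unfolding e\<^sub>2 using smallest_nat_equiv_quarter[OF pos two_neq_0] by blast
  have "card (\<Gamma>\<^sub>1 \<gamma> \<inter> \<Gamma>\<^sub>1 \<gamma>') = min s\<^sub>1 s\<^sub>2 \<or> card (\<Gamma>\<^sub>1 \<gamma> \<inter> \<Gamma>\<^sub>1 \<gamma>') = max s\<^sub>1 s\<^sub>2"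
    if "\<gamma> \<in> \<Phi> - \<Gamma>" "\<gamma>' \<in> \<Phi> - \<Gamma>" "\<gamma> \<noteq> \<gamma>'" for \<gamma> \<gamma>'
    using intersection_cases[OF that] smallest_nat_equiv_unique[OF s\<^sub>1] smallest_nat_equiv_unique[OF s\<^sub>2]
    by (auto simp: min_def max_def)
  then have "block_intersections (\<lambda>s. s = min s\<^sub>1 s\<^sub>2 \<or> s = max s\<^sub>1 s\<^sub>2)
      {#\<Gamma>\<^sub>1 \<gamma>. \<gamma> \<in># mset_set (\<Phi> - \<Gamma>)#}"
    by (intro block_intersections_image_mset_setI finite_Diff finite_\<Phi>)
  with s\<^sub>1 s\<^sub>2 show ?thesis by blast
qed

text \<open>The assumed size of \<Phi> leaves exactly \<open>card \<Gamma> choose 2\<close> vectors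
  outside \<Gamma>, which makes the incidence matrix of pairs and blocks square.\<close>

lemma four_design:
  assumes n: "card \<Phi> = card \<Gamma> * (card \<Gamma> + 1) div 2"
  shows "\<exists>lam. t_design 4 (card \<Gamma>) g\<^sub>1 lam \<Gamma> {#\<Gamma>\<^sub>1 \<gamma>. \<gamma> \<in># mset_set (\<Phi> - \<Gamma>)#}"
proof -
  interpret B: uniform_blocks "\<Phi> - \<Gamma>" \<Gamma> \<Gamma>\<^sub>1 g\<^sub>1 by (rule uniform_blocks_\<Gamma>\<^sub>1)
  let ?N = "\<lambda>S. card {\<gamma> \<in> \<Phi> - \<Gamma>. S \<subseteq> \<Gamma>\<^sub>1 \<gamma>}"
  have same: "?N S = ?N T" if S: "S \<subseteq> \<Gamma>" "card S = 4" and T: "T \<subseteq> \<Gamma>" "card T = 4" for S T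
  proof (cases "g\<^sub>1 \<ge> 2")
    case True
    have N: "card (\<Phi> - \<Gamma>) = card \<Gamma> choose 2"
    proof -
      have "card \<Gamma> * (card \<Gamma> + 1) = card \<Gamma> * (card \<Gamma> - 1) + 2 * card \<Gamma>"
        by (cases "card \<Gamma>") (simp_all add: algebra_simps)
      then have "card \<Phi> = card \<Gamma> * (card \<Gamma> - 1) div 2 + card \<Gamma>" using n by simp
      then show ?thesis using card_\<Phi>_eq by (simp add: choose_two)
    qed
    \<comment> \<open>A residue without a natural representative is attained by no pair of blocks;
      \<open>Suc g\<^sub>1\<close> is then a dummy value, chosen only to differ from the block
      size.\<close>
    have repr: "\<exists>x. x \<noteq> g\<^sub>1 \<and> (\<forall>s. smallest_nat_equiv c s \<longrightarrow> s = x)"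
      if "c \<noteq> of_nat g\<^sub>1" for c :: 'k
    proof (cases "\<exists>s. smallest_nat_equiv c s")
      case True
      then obtain s where s: "smallest_nat_equiv c s" by blast
      then have "s \<noteq> g\<^sub>1" using that by (auto simp: smallest_nat_equiv_def)
      then show ?thesis using smallest_nat_equiv_unique[OF s] by blast
    next
      case False
      then show ?thesis by (intro exI[of _ "Suc g\<^sub>1"]) auto
    qed
    have "of_nat g\<^sub>1 - (\<rho> - 1)\<^sup>2 / 4 \<noteq> of_nat g\<^sub>1" using \<rho>_neq four_neq_0 by simp
    then obtain x where x: "x \<noteq> g\<^sub>1" "\<And>s. smallest_nat_equiv (of_nat g\<^sub>1 - (\<rho> - 1)\<^sup>2 / 4) s \<Longrightarrow> s = x"
      using repr by blast
    have "of_nat g\<^sub>1 - (\<rho>\<^sup>2 - 1) / 4 \<noteq> of_nat g\<^sub>1"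
      using \<rho>_neq four_neq_0 by (simp add: power2_eq_1_iff)
    then obtain y where y: "y \<noteq> g\<^sub>1" "\<And>s. smallest_nat_equiv (of_nat g\<^sub>1 - (\<rho>\<^sup>2 - 1) / 4) s \<Longrightarrow> s = y"
      using repr by blast
    have "card (\<Gamma>\<^sub>1 i \<inter> \<Gamma>\<^sub>1 j) = x \<or> card (\<Gamma>\<^sub>1 i \<inter> \<Gamma>\<^sub>1 j) = y"
      if "i \<in> \<Phi> - \<Gamma>" "j \<in> \<Phi> - \<Gamma>" "i \<noteq> j" for i j
      using intersection_cases[OF that] x(2) y(2) by blast
    then show ?thesis by (rule B.quad_count_eq[OF N True _ x(1) y(1) S T])
  next
    case False
    have empty: "{\<gamma> \<in> \<Phi> - \<Gamma>. R \<subseteq> \<Gamma>\<^sub>1 \<gamma>} = {}" if "card R = 4" for R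
    proof -
      have "\<not> R \<subseteq> \<Gamma>\<^sub>1 \<gamma>" if "\<gamma> \<in> \<Phi> - \<Gamma>" for \<gamma>
      proof
        assume "R \<subseteq> \<Gamma>\<^sub>1 \<gamma>"
        then have "card R \<le> g\<^sub>1"
          using g\<^sub>1[OF that] splitsD(3)[OF that] finite_\<Gamma> by (metis card_mono finite_subset)
        then show False using False \<open>card R = 4\<close> by simp
      qed
      then show ?thesis by blast
    qed
    show ?thesis by (simp only: empty[OF S(2)] empty[OF T(2)])
  qed
  \<comment> \<open>\<open>T\<close> is an arbitrary reference 4-set. If \<Gamma> has no 4-subset,
    its value is junk and the constancy claim is vacuous.\<close>
  define T where "T = (SOME T. T \<subseteq> \<Gamma> \<and> card T = 4)"
  have const: "real (?N S) = real (?N T)" if "S \<subseteq> \<Gamma>" "card S = 4" for S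
  proof -
    have "T \<subseteq> \<Gamma> \<and> card T = 4" unfolding T_def
      by (rule someI[of "\<lambda>T. T \<subseteq> \<Gamma> \<and> card T = 4" S]) (use that in simp)
    then show ?thesis using same[OF that, of T] by simp
  qed
  have "t_design 4 (card \<Gamma>) g\<^sub>1 (real (?N T)) \<Gamma> {#\<Gamma>\<^sub>1 \<gamma>. \<gamma> \<in># mset_set (\<Phi> - \<Gamma>)#}"
    by (intro t_design_image_mset_setI B.finite_I B.finite_X refl B.block_subset B.card_block const)
  then show ?thesis by blast
qed

section \<open>Designs from the constant pair degree\<close>

context
  fixes l :: nat
  assumes pair_degree: "\<And>x y. x \<in> \<Phi> \<Longrightarrow> y \<in> \<Phi> \<Longrightarrow> x \<noteq> y \<Longrightarrow>
    card {t \<in> coherent_triples form \<beta> \<Phi>. {x, y} \<subseteq> t} = l"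
begin

lemma separation\<^sub>1:
  assumes "x \<in> \<Gamma>" "y \<in> \<Gamma>" "x \<noteq> y"
  shows "card {\<gamma> \<in> \<Phi> - \<Gamma>. (x \<in> \<Gamma>\<^sub>1 \<gamma>) \<noteq> (y \<in> \<Gamma>\<^sub>1 \<gamma>)} = l"
  using card_separating[OF assms] pair_degree[of x y] assms \<Gamma>_subset by auto

lemma separation\<^sub>2:
  assumes "x \<in> \<Gamma>" "y \<in> \<Gamma>" "x \<noteq> y"
  shows "card {\<gamma> \<in> \<Phi> - \<Gamma>. (x \<in> \<Gamma>\<^sub>2 \<gamma>) \<noteq> (y \<in> \<Gamma>\<^sub>2 \<gamma>)} = l"
proof -
  have "{\<gamma> \<in> \<Phi> - \<Gamma>. (x \<in> \<Gamma>\<^sub>2 \<gamma>) \<noteq> (y \<in> \<Gamma>\<^sub>2 \<gamma>)} = {\<gamma> \<in> \<Phi> - \<Gamma>. (x \<in> \<Gamma>\<^sub>1 \<gamma>) \<noteq> (y \<in> \<Gamma>\<^sub>1 \<gamma>)}"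
    using splitsD(4) assms by auto
  then show ?thesis using separation\<^sub>1[OF assms] by simp
qed

text \<open>Without vectors outside \<Gamma> no pair of points is separated, so \<open>l = 0\<close>
  as soon as \<Gamma> has two points, and there is nothing to show otherwise. The factor
  \<open>r\<close> is arbitrary because \<open>g\<^sub>1\<close> or \<open>g\<^sub>2\<close> may be
  zero in this case, which makes the quotient in the index degenerate.\<close>

lemma trivial_design:
  assumes "\<Phi> = \<Gamma>"
  shows "t_design 2 (card \<Gamma>) k (real l * r) \<Gamma> {#}"
  unfolding t_design_def
proof (intro conjI allI impI)
  fix S assume "S \<subseteq> \<Gamma> \<and> card S = 2"
  then obtain x y where "x \<in> \<Gamma>" "y \<in> \<Gamma>" "x \<noteq> y" by (auto simp: card_2_iff)
  then have "l = 0" using separation\<^sub>1[of x y] assms by simp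
  then show "real (size {#b \<in># {#}. S \<subseteq> b#}) = real l * r" by simp
qed (use finite_\<Gamma> in auto)

lemma two_design\<^sub>1:
  assumes g: "g\<^sub>1 \<noteq> g\<^sub>2"
  shows "t_design 2 (card \<Gamma>) g\<^sub>1 (real l * (real g\<^sub>1 - 1) / (2 * real g\<^sub>2)) \<Gamma>
    {#\<Gamma>\<^sub>1 \<gamma>. \<gamma> \<in># mset_set (\<Phi> - \<Gamma>)#}"
proof (cases "\<Phi> = \<Gamma>")
  case True
  then show ?thesis using trivial_design[OF True, of g\<^sub>1 "(real g\<^sub>1 - 1) / (2 * real g\<^sub>2)"] by simp
next
  case False
  then obtain \<gamma> where \<gamma>: "\<gamma> \<in> \<Phi> - \<Gamma>" using \<Gamma>_subset by blast
  have c: "card \<Gamma> - g\<^sub>1 = g\<^sub>2" "2 * g\<^sub>1 \<noteq> card \<Gamma>" "g\<^sub>1 < card \<Gamma>"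
    using g g\<^sub>2 g_pos(2)[OF \<gamma>] by auto
  show ?thesis
    using uniform_blocks.separation_t_design[OF uniform_blocks_\<Gamma>\<^sub>1 separation\<^sub>1 refl c(2,3)]
    unfolding c(1) .
qed

lemma two_design\<^sub>2:
  assumes g: "g\<^sub>1 \<noteq> g\<^sub>2"
  shows "t_design 2 (card \<Gamma>) g\<^sub>2 (real l * (real g\<^sub>2 - 1) / (2 * real g\<^sub>1)) \<Gamma>
    {#\<Gamma>\<^sub>2 \<gamma>. \<gamma> \<in># mset_set (\<Phi> - \<Gamma>)#}"
proof (cases "\<Phi> = \<Gamma>")
  case True
  then show ?thesis using trivial_design[OF True, of g\<^sub>2 "(real g\<^sub>2 - 1) / (2 * real g\<^sub>1)"] by simp
next
  case False
  then obtain \<gamma> where \<gamma>: "\<gamma> \<in> \<Phi> - \<Gamma>" using \<Gamma>_subset by blast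
  have c: "card \<Gamma> - g\<^sub>2 = g\<^sub>1" "2 * g\<^sub>2 \<noteq> card \<Gamma>" "g\<^sub>2 < card \<Gamma>"
    using g g\<^sub>2 g_pos(1)[OF \<gamma>] by auto
  show ?thesis
    using uniform_blocks.separation_t_design[OF uniform_blocks_\<Gamma>\<^sub>2 separation\<^sub>2 refl c(2,3)]
    unfolding c(1) .
qed

text \<open>For each \<gamma> exactly one of three things happens: both points lie in
  \<open>\<Gamma>\<^sub>1 \<gamma>\<close>, both lie in \<open>\<Gamma>\<^sub>2 \<gamma>\<close>, or
  \<gamma> separates them. The last occurs \<open>l\<close> times.\<close>

lemma halving_design:
  assumes g: "g\<^sub>1 = g\<^sub>2"
  shows "t_design 2 (card \<Gamma>) (card \<Gamma> div 2) (real (card \<Phi>) - real (card \<Gamma>) - real l) \<Gamma>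
    ({#\<Gamma>\<^sub>1 \<gamma>. \<gamma> \<in># mset_set (\<Phi> - \<Gamma>)#} + {#\<Gamma>\<^sub>2 \<gamma>. \<gamma> \<in># mset_set (\<Phi> - \<Gamma>)#})"
  unfolding t_design_def
proof (intro conjI allI impI ballI)
  interpret B1: uniform_blocks "\<Phi> - \<Gamma>" \<Gamma> \<Gamma>\<^sub>1 g\<^sub>1 by (rule uniform_blocks_\<Gamma>\<^sub>1)
  interpret B2: uniform_blocks "\<Phi> - \<Gamma>" \<Gamma> \<Gamma>\<^sub>2 g\<^sub>2 by (rule uniform_blocks_\<Gamma>\<^sub>2)
  show "finite \<Gamma>" by (rule finite_\<Gamma>)
  fix b assume b: "b \<in># {#\<Gamma>\<^sub>1 \<gamma>. \<gamma> \<in># mset_set (\<Phi> - \<Gamma>)#} + {#\<Gamma>\<^sub>2 \<gamma>. \<gamma> \<in># mset_set (\<Phi> - \<Gamma>)#}"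
  have half: "card \<Gamma> div 2 = g\<^sub>1" using g g\<^sub>2 by simp
  show "b \<subseteq> \<Gamma>" "card b = card \<Gamma> div 2"
    using b B1.block_subset B2.block_subset B1.card_block B2.card_block finite_\<Phi> half g by auto
next
  fix S assume "S \<subseteq> \<Gamma> \<and> card S = 2"
  then obtain x y where xy: "S = {x, y}" "x \<in> \<Gamma>" "y \<in> \<Gamma>" "x \<noteq> y" by (auto simp: card_2_iff)
  let ?I = "\<Phi> - \<Gamma>"
  have fin: "finite ?I" using finite_\<Phi> by simp
  have "card {\<gamma> \<in> ?I. S \<subseteq> \<Gamma>\<^sub>1 \<gamma>} + card {\<gamma> \<in> ?I. S \<subseteq> \<Gamma>\<^sub>2 \<gamma>} + l
      = (\<Sum>\<gamma>\<in>?I. of_bool (S \<subseteq> \<Gamma>\<^sub>1 \<gamma>) + of_bool (S \<subseteq> \<Gamma>\<^sub>2 \<gamma>) + of_bool ((x \<in> \<Gamma>\<^sub>1 \<gamma>) \<noteq> (y \<in> \<Gamma>\<^sub>1 \<gamma>)))"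
    using separation\<^sub>1[OF xy(2-4)] card_Collect_eq_sum[OF fin, where 'a=nat]
    by (simp only: sum.distrib of_nat_id)
  also have "\<dots> = (\<Sum>\<gamma>\<in>?I. 1)"
    using splitsD(4) xy by (intro sum.cong refl) auto
  finally have "card {\<gamma> \<in> ?I. S \<subseteq> \<Gamma>\<^sub>1 \<gamma>} + card {\<gamma> \<in> ?I. S \<subseteq> \<Gamma>\<^sub>2 \<gamma>} + l = card ?I" by simp
  then show "real (size {#b \<in># {#\<Gamma>\<^sub>1 \<gamma>. \<gamma> \<in># mset_set ?I#} + {#\<Gamma>\<^sub>2 \<gamma>. \<gamma> \<in># mset_set ?I#}. S \<subseteq> b#})
      = real (card \<Phi>) - real (card \<Gamma>) - real l"
    using card_\<Phi>_eq fin by (simp add: size_filter_image_mset_set)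
qed simp

text \<open>Needed to exclude halves when there are as many blocks as points. Double counting leaves
  only two points and two blocks of size one; there the Gram relations give
  \<open>\<rho> = 2\<close> and \<open>3 = 0\<close>, hence the forbidden
  \<open>\<rho> = -1\<close>.\<close>

lemma halves_imp_card_neq:
  assumes g: "g\<^sub>1 = g\<^sub>2" and ne: "\<Phi> \<noteq> \<Gamma>"
  shows "card (\<Phi> - \<Gamma>) \<noteq> card \<Gamma>"
proof
  assume N: "card (\<Phi> - \<Gamma>) = card \<Gamma>"
  obtain \<gamma> where \<gamma>: "\<gamma> \<in> \<Phi> - \<Gamma>" using ne \<Gamma>_subset by blast
  have d: "card \<Gamma> = 2 * g\<^sub>1" using g g\<^sub>2 by simp
  have gpos: "g\<^sub>1 > 0" using g_pos(1)[OF \<gamma>] .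
  then obtain x where x: "x \<in> \<Gamma>" using d by fastforce
  have "real (card \<Gamma>) * real g\<^sub>1 = (real (card \<Gamma>) - 1) * real l"
    using uniform_blocks.separation_count[OF uniform_blocks_\<Gamma>\<^sub>1 separation\<^sub>1 x] N d by simp
  then have "real_of_int (2 * int g\<^sub>1 * int g\<^sub>1) = real_of_int ((2 * int g\<^sub>1 - 1) * int l)"
    unfolding d by simp
  then have "2 * int g\<^sub>1 * int g\<^sub>1 = (2 * int g\<^sub>1 - 1) * int l" by (simp only: of_int_eq_iff)
  \<comment> \<open>The number \<open>2 * g\<^sub>1 - 1\<close> divides twice the left side of the
    count, and by this identity also that number minus one; hence it divides 1.\<close>
  moreover have "(2 * int g\<^sub>1 - 1) * (2 * int g\<^sub>1 + 1) = 2 * (2 * int g\<^sub>1 * int g\<^sub>1) - 1"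
    by (simp add: algebra_simps)
  ultimately have "(2 * int g\<^sub>1 - 1) * (2 * int l - (2 * int g\<^sub>1 + 1)) = 1"
    by (simp add: algebra_simps)
  then have "2 * int g\<^sub>1 - 1 = 1" using gpos by (simp add: zmult_eq_1_iff)
  then have g1: "g\<^sub>1 = 1" by simp
  have d2: "card \<Gamma> = 2" using d g1 by simp
  obtain \<tau> :: "'v \<Rightarrow> 'k" where \<tau>: "\<And>\<gamma>. \<gamma> \<in> \<Phi> - \<Gamma> \<Longrightarrow> \<tau> \<gamma> = 1 \<or> \<tau> \<gamma> = -1"
    and gram: "\<And>\<gamma> \<gamma>'. \<gamma> \<in> \<Phi> - \<Gamma> \<Longrightarrow> \<gamma>' \<in> \<Phi> - \<Gamma> \<Longrightarrow> 4 * of_nat (card (\<Gamma>\<^sub>1 \<gamma> \<inter> \<Gamma>\<^sub>1 \<gamma>'))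
        = 4 * of_nat g\<^sub>1 - \<rho> * (\<rho> - 1) + (\<rho> - 1) * (\<tau> \<gamma> * \<tau> \<gamma>' * nform \<gamma> \<gamma>')"
    and dd: "\<And>\<gamma>. \<gamma> \<in> \<Phi> - \<Gamma> \<Longrightarrow> g\<^sub>1 = g\<^sub>2 \<Longrightarrow> \<rho> * (\<rho> - 1) = of_nat (card \<Gamma>)"
    by (rule gram_outside) blast
  have "\<rho> * (\<rho> - 1) = 2" using dd[OF \<gamma> g] d2 by simp
  then have "(\<rho> - 2) * (\<rho> + 1) = 0" by (simp add: algebra_simps)
  moreover have "\<rho> + 1 \<noteq> 0" using \<rho>_neq(2) by (simp add: eq_neg_iff_add_eq_0)
  ultimately have \<rho>: "\<rho> = 2" by simp
  have "card (\<Phi> - \<Gamma> - {\<gamma>}) = 1" using N d2 \<gamma> by (simp add: card_Diff_singleton)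
  then obtain \<gamma>' where "\<Phi> - \<Gamma> - {\<gamma>} = {\<gamma>'}" by (rule card_1_singletonE)
  then have \<gamma>': "\<gamma>' \<in> \<Phi> - \<Gamma>" "\<gamma>' \<noteq> \<gamma>" by blast+
  define t where "t = \<tau> \<gamma> * \<tau> \<gamma>' * nform \<gamma> \<gamma>'"
  have t: "t = 1 \<or> t = -1"
    using \<tau>[OF \<gamma>] \<tau>[OF \<gamma>'(1)] nform_cases[of \<gamma> \<gamma>'] \<gamma> \<gamma>' by (auto simp: t_def)
  have "card (\<Gamma>\<^sub>1 \<gamma> \<inter> \<Gamma>\<^sub>1 \<gamma>') \<le> card (\<Gamma>\<^sub>1 \<gamma>)"
    using splitsD(3)[OF \<gamma>] finite_\<Gamma> by (intro card_mono) (auto intro: finite_subset)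
  then have "card (\<Gamma>\<^sub>1 \<gamma> \<inter> \<Gamma>\<^sub>1 \<gamma>') = 0 \<or> card (\<Gamma>\<^sub>1 \<gamma> \<inter> \<Gamma>\<^sub>1 \<gamma>') = 1"
    using g\<^sub>1[OF \<gamma>] g1 by linarith
  moreover have "4 * of_nat (card (\<Gamma>\<^sub>1 \<gamma> \<inter> \<Gamma>\<^sub>1 \<gamma>')) = 2 + t"
    using gram[OF \<gamma> \<gamma>'(1)] unfolding \<rho> g1 t_def by simp
  ultimately have "2 + t = 0 \<or> 2 + t = 4" by auto
  \<comment> \<open>For \<open>t = 1\<close> the alternatives read 3 = 0 and 3 = 4, for
    \<open>t = -1\<close> they read 1 = 0 and 1 = 4. Those that do not collapse the field say 3 =
    0.\<close>
  then have "(3::'k) = 0"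
  proof (elim disjE)
    assume "2 + t = 0"
    then have "t = -2" by (simp add: eq_neg_iff_add_eq_0 add.commute)
    with t show ?thesis
    proof (elim disjE)
      assume "t = 1" "t = -2"
      then have "1 + 2 = (0::'k)" by simp
      then show ?thesis by simp
    next
      assume "t = -1" "t = -2"
      then have "(1::'k) = 2" by simp
      then have "(2::'k) - 1 = 0" by simp
      then show ?thesis by simp
    qed
  next
    assume "2 + t = 4"
    then have "t = 4 - 2" by (simp add: eq_diff_eq add.commute)
    then have "t = 2" by simp
    with t show ?thesis
    proof (elim disjE)
      assume "t = 1" "t = 2"
      then have "(2::'k) - 1 = 0" by simp
      then show ?thesis by simp
    next
      assume "t = -1" "t = 2"
      then have "(2::'k) = -1" by simp
      then have "(2::'k) + 1 = 0" by simp
      then show ?thesis by simp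
    qed
  qed
  then have "(2::'k) + 1 = 0" by simp
  then have "\<rho> = -1" unfolding \<rho> by (simp only: eq_neg_iff_add_eq_0)
  then show False using \<rho>_neq(2) by simp
qed

text \<open>In a symmetric design all pairs of distinct blocks meet in the same number of points, so
  the residue attained by a single pair decides which of the two alternatives holds
  throughout.\<close>

lemma symmetric_case:
  assumes n: "card \<Phi> = 2 * card \<Gamma>"
  shows "symmetric_design (card \<Gamma>) g\<^sub>1 (real l * (real g\<^sub>1 - 1) / (2 * real g\<^sub>2)) \<Gamma>
      {#\<Gamma>\<^sub>1 \<gamma>. \<gamma> \<in># mset_set (\<Phi> - \<Gamma>)#}" (is ?A)
    and "block_intersections (smallest_nat_equiv (of_nat g\<^sub>1 - (\<rho> - 1)\<^sup>2 / 4))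
        {#\<Gamma>\<^sub>1 \<gamma>. \<gamma> \<in># mset_set (\<Phi> - \<Gamma>)#} \<or>
      block_intersections (smallest_nat_equiv (of_nat g\<^sub>1 - (\<rho>\<^sup>2 - 1) / 4))
        {#\<Gamma>\<^sub>1 \<gamma>. \<gamma> \<in># mset_set (\<Phi> - \<Gamma>)#}" (is ?B)
proof -
  have N: "card (\<Phi> - \<Gamma>) = card \<Gamma>" using n card_\<Phi>_eq by simp
  have "?A \<and> ?B"
  proof (cases "\<Phi> = \<Gamma>")
    case True
    \<comment> \<open>Here there are no blocks and as many blocks as points, so \<Gamma> is
      empty.\<close>
    have "size {#\<Gamma>\<^sub>1 \<gamma>. \<gamma> \<in># mset_set (\<Phi> - \<Gamma>)#} = card \<Gamma>" using N by simp
    then show ?thesis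
      using True trivial_design[OF True, of g\<^sub>1 "(real g\<^sub>1 - 1) / (2 * real g\<^sub>2)"]
      by (simp add: symmetric_design_def block_intersections_def)
  next
    case False
    then obtain \<gamma> where \<gamma>: "\<gamma> \<in> \<Phi> - \<Gamma>" using \<Gamma>_subset by blast
    have g: "g\<^sub>1 \<noteq> g\<^sub>2" using halves_imp_card_neq[OF _ False] N by blast
    interpret B: uniform_blocks "\<Phi> - \<Gamma>" \<Gamma> \<Gamma>\<^sub>1 g\<^sub>1 by (rule uniform_blocks_\<Gamma>\<^sub>1)
    have A: ?A using two_design\<^sub>1[OF g] N by (simp add: symmetric_design_def)
    have k: "2 * g\<^sub>1 \<noteq> card \<Gamma>" "g\<^sub>1 < card \<Gamma>" using g g\<^sub>2 g_pos(2)[OF \<gamma>] by auto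
    have c: "2 * (real (card \<Gamma>) - real g\<^sub>1) \<noteq> 0" using k(2) by simp
    have r: "real (card {i \<in> \<Phi> - \<Gamma>. x \<in> \<Gamma>\<^sub>1 i})
        = (real (card \<Gamma>) - 1) * real l / (2 * (real (card \<Gamma>) - real g\<^sub>1))" if "x \<in> \<Gamma>" for x
      using B.separation_replication[OF separation\<^sub>1 that k] c by (simp only: eq_divide_eq) simp
    define lam where "lam = real l * (real g\<^sub>1 - 1) / (2 * (real (card \<Gamma>) - real g\<^sub>1))"
    have lam: "real (card (\<Gamma>\<^sub>1 i \<inter> \<Gamma>\<^sub>1 j)) = lam"
      if "i \<in> \<Phi> - \<Gamma>" "j \<in> \<Phi> - \<Gamma>" "i \<noteq> j" for i j
      unfolding lam_def
      by (rule B.symmetric_design_intersection[OF N r B.separation_pair[OF separation\<^sub>1 _ _ _ k] that])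
    have ?B
    proof (cases "\<exists>i\<in>\<Phi> - \<Gamma>. \<exists>j\<in>\<Phi> - \<Gamma>. i \<noteq> j")
      case True
      then obtain i j where ij: "i \<in> \<Phi> - \<Gamma>" "j \<in> \<Phi> - \<Gamma>" "i \<noteq> j" by blast
      have "card (\<Gamma>\<^sub>1 i' \<inter> \<Gamma>\<^sub>1 j') = card (\<Gamma>\<^sub>1 i \<inter> \<Gamma>\<^sub>1 j)"
        if "i' \<in> \<Phi> - \<Gamma>" "j' \<in> \<Phi> - \<Gamma>" "i' \<noteq> j'" for i' j'
        using lam[OF that] lam[OF ij] by simp
      then have const: "block_intersections P {#\<Gamma>\<^sub>1 \<gamma>. \<gamma> \<in># mset_set (\<Phi> - \<Gamma>)#}"
        if "P (card (\<Gamma>\<^sub>1 i \<inter> \<Gamma>\<^sub>1 j))" for P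
        using that by (intro block_intersections_image_mset_setI[OF B.finite_I]) simp
      show ?thesis using intersection_cases[OF ij] by (elim disjE) (simp_all add: const)
    next
      case False
      then show ?thesis
        by (intro disjI1 block_intersections_image_mset_setI[OF B.finite_I]) blast
    qed
    with A show ?thesis by blast
  qed
  then show ?A ?B by auto
qed

end

end

theorem theorem7p12:
  fixes scale :: "'k::{finite,field} \<Rightarrow> 'v::ab_group_add \<Rightarrow> 'v"
    and Basis :: "'v set"
    and form :: "'v \<Rightarrow> 'v \<Rightarrow> 'k"
    and \<Phi> \<Gamma> :: "'v set"
    and \<Gamma>\<^sub>1 \<Gamma>\<^sub>2 :: "'v \<Rightarrow> 'v set"
    and a b \<beta> \<rho> :: 'k
    and n d l m g\<^sub>1 g\<^sub>2 :: nat
    and \<B>\<^sub>1 \<B>\<^sub>2 :: "'v set multiset"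
    and lam\<^sub>1 lam\<^sub>2 :: real
  assumes geometry: "orthogonal_geometry scale Basis form"
    and dim: "vector_space.dim scale (UNIV :: 'v set) = d"
    and equiangular: "equiangular form a b \<Phi>" and card_\<Phi>: "card \<Phi> = n"
    and ab: "a\<^sup>2 \<noteq> b" and a: "a \<noteq> 0"
    and char: "CHAR('k) > d"
    and \<beta>: "\<beta> \<noteq> 0" "\<beta>\<^sup>2 = b"
    and regular: "regular_two_graph \<Phi> (coherent_triples form \<beta> \<Phi>) n l m"
    and max_incoherent: "max_incoherent form \<beta> \<Phi> \<Gamma>"
    and card_\<Gamma>: "card \<Gamma> = d"
    and independent: "\<not> module.dependent scale \<Gamma>"
    and splits: "\<And>\<gamma>. \<gamma> \<in> \<Phi> - \<Gamma> \<Longrightarrow> splits form \<beta> \<Phi> \<Gamma> \<gamma> (\<Gamma>\<^sub>1 \<gamma>) (\<Gamma>\<^sub>2 \<gamma>)"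
    and g\<^sub>1: "\<And>\<gamma>. \<gamma> \<in> \<Phi> - \<Gamma> \<Longrightarrow> card (\<Gamma>\<^sub>1 \<gamma>) = g\<^sub>1"
    and g\<^sub>2: "g\<^sub>1 + g\<^sub>2 = card \<Gamma>"
  defines "\<B>\<^sub>1 \<equiv> {#\<Gamma>\<^sub>1 \<gamma>. \<gamma> \<in># mset_set (\<Phi> - \<Gamma>)#}"
    and "\<B>\<^sub>2 \<equiv> {#\<Gamma>\<^sub>2 \<gamma>. \<gamma> \<in># mset_set (\<Phi> - \<Gamma>)#}"
    and "lam\<^sub>1 \<equiv> real l * (real g\<^sub>1 - 1) / (2 * real g\<^sub>2)"
    and "lam\<^sub>2 \<equiv> real l * (real g\<^sub>2 - 1) / (2 * real g\<^sub>1)"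
    and "\<rho> \<equiv> a * inverse \<beta>"
  shows "(g\<^sub>1 \<noteq> g\<^sub>2 \<longrightarrow>
            t_design 2 d g\<^sub>1 lam\<^sub>1 \<Gamma> \<B>\<^sub>1 \<and> t_design 2 d g\<^sub>2 lam\<^sub>2 \<Gamma> \<B>\<^sub>2 \<and>
            (n > 2 * d \<longrightarrow>
               (\<exists>s\<^sub>1 s\<^sub>2. smallest_nat_equiv (of_nat g\<^sub>1 - (\<rho> - 1)\<^sup>2 / 4) s\<^sub>1 \<and>
                  smallest_nat_equiv (of_nat g\<^sub>1 - (\<rho>\<^sup>2 - 1) / 4) s\<^sub>2 \<and>
                  quasi_symmetric d g\<^sub>1 lam\<^sub>1 (min s\<^sub>1 s\<^sub>2) (max s\<^sub>1 s\<^sub>2) \<Gamma> \<B>\<^sub>1))) \<and>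
         (n = d * (d + 1) div 2 \<longrightarrow> (\<exists>lam. t_design 4 d g\<^sub>1 lam \<Gamma> \<B>\<^sub>1)) \<and>
         (n = 2 * d \<longrightarrow>
            symmetric_design d g\<^sub>1 lam\<^sub>1 \<Gamma> \<B>\<^sub>1 \<and>
            (block_intersections (smallest_nat_equiv (of_nat g\<^sub>1 - (\<rho> - 1)\<^sup>2 / 4)) \<B>\<^sub>1 \<or>
             block_intersections (smallest_nat_equiv (of_nat g\<^sub>1 - (\<rho>\<^sup>2 - 1) / 4)) \<B>\<^sub>1)) \<and>
         (g\<^sub>1 = g\<^sub>2 \<longrightarrow>
            t_design 2 d (d div 2) (real n - real d - real l) \<Gamma> (\<B>\<^sub>1 + \<B>\<^sub>2))"
proof -
  have finite_\<Phi>: "finite \<Phi>"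
    using regular by (simp add: regular_two_graph_def two_graph_def)
  interpret orthogonal_geometry scale Basis form by (rule geometry)
  interpret G: incoherent_basis scale Basis form \<Phi> \<Gamma> \<Gamma>\<^sub>1 \<Gamma>\<^sub>2 a b \<beta> g\<^sub>1 g\<^sub>2
  proof
    show "card \<Gamma> = dim UNIV" using card_\<Gamma> dim by simp
    show "CHAR('k) > card \<Gamma>" using char card_\<Gamma> by simp
  qed (fact finite_\<Phi> equiangular ab \<beta> max_incoherent independent splits g\<^sub>1 g\<^sub>2 | assumption)+
  have \<rho>: "G.\<rho> = \<rho>" by (simp add: G.\<rho>_def \<rho>_def)
  have deg: "card {t \<in> coherent_triples form \<beta> \<Phi>. {x, y} \<subseteq> t} = l"
    if "x \<in> \<Phi>" "y \<in> \<Phi>" "x \<noteq> y" for x y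
    using regular that by (simp add: regular_two_graph_def)
  have N: "n = d + card (\<Phi> - \<Gamma>)" using G.card_\<Phi>_eq card_\<Phi> card_\<Gamma> by simp
  note defs = \<B>\<^sub>1_def \<B>\<^sub>2_def lam\<^sub>1_def lam\<^sub>2_def
  have two\<^sub>1: "t_design 2 d g\<^sub>1 lam\<^sub>1 \<Gamma> \<B>\<^sub>1" if "g\<^sub>1 \<noteq> g\<^sub>2"
    using G.two_design\<^sub>1[OF deg that] card_\<Gamma> by (simp add: defs)
  have two\<^sub>2: "t_design 2 d g\<^sub>2 lam\<^sub>2 \<Gamma> \<B>\<^sub>2" if "g\<^sub>1 \<noteq> g\<^sub>2"
    using G.two_design\<^sub>2[OF deg that] card_\<Gamma> by (simp add: defs)
  have quasi: "\<exists>s\<^sub>1 s\<^sub>2. smallest_nat_equiv (of_nat g\<^sub>1 - (\<rho> - 1)\<^sup>2 / 4) s\<^sub>1 \<and>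
      smallest_nat_equiv (of_nat g\<^sub>1 - (\<rho>\<^sup>2 - 1) / 4) s\<^sub>2 \<and>
      quasi_symmetric d g\<^sub>1 lam\<^sub>1 (min s\<^sub>1 s\<^sub>2) (max s\<^sub>1 s\<^sub>2) \<Gamma> \<B>\<^sub>1"
    if "g\<^sub>1 \<noteq> g\<^sub>2" "n > 2 * d"
  proof -
    have "card (\<Phi> - \<Gamma>) > card \<Gamma>" using that(2) N card_\<Gamma> by simp
    from G.quasi_symmetric_intersections[OF this, unfolded \<rho>, folded \<B>\<^sub>1_def]
    obtain s\<^sub>1 s\<^sub>2 where s: "smallest_nat_equiv (of_nat g\<^sub>1 - (\<rho> - 1)\<^sup>2 / 4) s\<^sub>1"
      "smallest_nat_equiv (of_nat g\<^sub>1 - (\<rho>\<^sup>2 - 1) / 4) s\<^sub>2"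
      "block_intersections (\<lambda>s. s = min s\<^sub>1 s\<^sub>2 \<or> s = max s\<^sub>1 s\<^sub>2) \<B>\<^sub>1" by blast
    have "quasi_symmetric d g\<^sub>1 lam\<^sub>1 (min s\<^sub>1 s\<^sub>2) (max s\<^sub>1 s\<^sub>2) \<Gamma> \<B>\<^sub>1"
      unfolding quasi_symmetric_def using two\<^sub>1[OF that(1)] s(3) by simp
    with s show ?thesis by blast
  qed
  have four: "\<exists>lam. t_design 4 d g\<^sub>1 lam \<Gamma> \<B>\<^sub>1" if "n = d * (d + 1) div 2"
    using G.four_design that card_\<Phi> card_\<Gamma> by (simp add: defs)
  have sym: "symmetric_design d g\<^sub>1 lam\<^sub>1 \<Gamma> \<B>\<^sub>1"
    "block_intersections (smallest_nat_equiv (of_nat g\<^sub>1 - (\<rho> - 1)\<^sup>2 / 4)) \<B>\<^sub>1 \<or>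
     block_intersections (smallest_nat_equiv (of_nat g\<^sub>1 - (\<rho>\<^sup>2 - 1) / 4)) \<B>\<^sub>1" if "n = 2 * d"
  proof -
    have "card \<Phi> = 2 * card \<Gamma>" using that card_\<Phi> card_\<Gamma> by simp
    from G.symmetric_case[OF deg this] show "symmetric_design d g\<^sub>1 lam\<^sub>1 \<Gamma> \<B>\<^sub>1"
      "block_intersections (smallest_nat_equiv (of_nat g\<^sub>1 - (\<rho> - 1)\<^sup>2 / 4)) \<B>\<^sub>1 \<or>
       block_intersections (smallest_nat_equiv (of_nat g\<^sub>1 - (\<rho>\<^sup>2 - 1) / 4)) \<B>\<^sub>1"
      unfolding \<rho> card_\<Gamma> defs by blast+
  qed
  have half: "t_design 2 d (d div 2) (real n - real d - real l) \<Gamma> (\<B>\<^sub>1 + \<B>\<^sub>2)" if "g\<^sub>1 = g\<^sub>2"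
    using G.halving_design[OF deg that] card_\<Phi> card_\<Gamma> by (simp add: defs)
  show ?thesis by (intro conjI impI two\<^sub>1 two\<^sub>2 quasi four sym half)
qed

end
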